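(* Let $F=\{P_1,\ldots,P_m\}\subseteq \mathcal{D}$ with $P_i\neq 0$ for $i=1,\ldots,m$, and let $P\in\mathcal{D}$. Then there exist $Q_1,\ldots,Q_m,R\in\mathcal{D}$ such that: 1. $P=\sum_{i=1}^m Q_iP_i+R$; 2. $R$ is reduced with respect to $F$; 3. $\max_{1\le i\le m}\{\exp^\delta(Q_iP_i),\exp^\delta(R)\}=\exp^\delta(P)$.
   Context: $\mathbf{k}$ is a field of characteristic zero, $n\ge 1$, $m'\ge 0$, and $\mathbf{k}((\tilde X))$ is the fraction field of the formal power series ring $\mathbf{k}[[x_1,\ldots,x_{n+m'}]]$. $\mathcal{H}\subset \mathbf{k}((\tilde X))$ is a noetherian $\mathbf{k}$-subalgebra stable under the partial derivatives $\partial_1,\ldots,\partial_n$ (with respect to $x_1,\ldots,x_n$). It is also assumed to be effective: (1) for any finite subset $\{f_1,\ldots,f_r\}\subset\mathcal{H}$ and $f\in\mathcal{H}$ one can decide whether $f$ lies in the ideal generated by $f_1,\ldots,f_r$ and, if so, find $q_i\in\mathcal{H}$ with $f=\sum q_if_i$; (2) for any finite subset of $\mathcal{H}$ one can find a system of generators of its $\mathcal{H}$-module of syzygies. $\mathcal{D}=\mathcal{H}[\partial]=\mathcal{H}[\partial_1,\ldots,\partial_n]$ is the ring of linear differential operators generated by $\mathcal{H}$ and $\partial_1,\ldots,\partial_n$; its elements are the finite sums $\sum_{\alpha\in\mathbb{N}^n}p_\alpha\partial^\alpha$ with $p_\alpha\in\mathcal{H}$ (unique expression), $0\in\mathbb{N}$.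 Fix a (total) well-ordering $<$ on $\mathbb{N}^n$ compatible with the sum: $\alpha+\gamma<\beta+\gamma$ iff $\alpha<\beta$. For nonzero $P=\sum p_\alpha\partial^\alpha\in\mathcal{D}$, the $\delta$-exponent is $\exp^\delta(P)=\max_<\{\alpha: p_\alpha\ne 0\}$ and the $\delta$-coefficient is $c^\delta(P)=p_{\exp^\delta(P)}\in\mathcal{H}$. By convention $\exp^\delta(0)=-\infty$, smaller than every element of $\mathbb{N}^n$. For a set $F\subseteq\mathcal{D}\setminus\{0\}$ and $\alpha\in\mathbb{N}^n$, $C(\alpha;F)$ is the ideal of $\mathcal{H}$ generated by $\{c^\delta(P): P\in F,\ \alpha\in\exp^\delta(P)+\mathbb{N}^n\}$ (it is $\{0\}$ if this set is empty). A nonzero $P\in\mathcal{D}$ is reduced with respect to $F=\{P_1,\ldots,P_m\}$ if either $\exp^\delta(P)\notin\bigcup_{i}(\exp^\delta(P_i)+\mathbb{N}^n)$, or $\exp^\delta(P)\in\bigcup_{i}(\exp^\delta(P_i)+\mathbb{N}^n)$ and $c^\delta(P)\notin C(\exp^\delta(P);F)$. The zero operator is regarded as reduced. *)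

theory Defs
  imports
    "HOL-Library.Function_Algebras"
    "HOL-Computational_Algebra.Fraction_Field"
    "HOL-Algebra.Subrings"
    "HOL-Algebra.Ring_Divisibility"
    "HOL-Algebra.Algebraic_Closure_Type"
begin

section \<open>Formal power series in finitely many variables\<close>

text \<open>Exponents are functions \<^typ>\<open>'v \<Rightarrow> nat\<close> on the finite type of variables; they carry the
  pointwise addition, subtraction and (componentwise) order.\<close>

typedef (overloaded) ('v, 'a) mfps = "UNIV :: (('v \<Rightarrow> nat) \<Rightarrow> 'a) set"
  morphisms mcoeff MFPS ..

lemma mcoeff_MFPS [simp]: "mcoeff (MFPS f) = f"
  by (simp add: MFPS_inverse)

lemma mfps_eq_iff: "f = g \<longleftrightarrow> (\<forall>\<alpha>. mcoeff f \<alpha> = mcoeff g \<alpha>)"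
  by (metis ext mcoeff_inject)

lemma finite_atMost_exponent [simp]: "finite {\<beta>. \<beta> \<le> (\<alpha> :: 'v::finite \<Rightarrow> nat)}"
proof (rule finite_subset)
  show "{\<beta>. \<beta> \<le> \<alpha>} \<subseteq> PiE UNIV (\<lambda>i. {..\<alpha> i})"
    by (auto simp: le_fun_def)
  show "finite (PiE UNIV (\<lambda>i. {..\<alpha> i}))"
    by (rule finite_PiE) auto
qed

instantiation mfps :: (type, zero) zero
begin
definition "0 = MFPS (\<lambda>_. 0)"
instance ..
end

instantiation mfps :: (type, zero_neq_one) one
begin
definition "1 = MFPS (\<lambda>\<alpha>. if \<alpha> = (\<lambda>_. 0) then 1 else 0)"
instance ..
end

instantiation mfps :: (type, plus) plus
begin
definition "f + g = MFPS (\<lambda>\<alpha>. mcoeff f \<alpha> + mcoeff g \<alpha>)"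
instance ..
end

instantiation mfps :: (type, minus) minus
begin
definition "f - g = MFPS (\<lambda>\<alpha>. mcoeff f \<alpha> - mcoeff g \<alpha>)"
instance ..
end

instantiation mfps :: (type, uminus) uminus
begin
definition "- f = MFPS (\<lambda>\<alpha>. - mcoeff f \<alpha>)"
instance ..
end

instantiation mfps :: (finite, semiring_0) times
begin
definition "f * g = MFPS (\<lambda>\<alpha>. \<Sum>\<beta> | \<beta> \<le> \<alpha>. mcoeff f \<beta> * mcoeff g (\<alpha> - \<beta>))"
instance ..
end

lemma mcoeff_simps [simp]:
  "mcoeff 0 \<alpha> = 0"
  "mcoeff (f + g) \<alpha> = mcoeff f \<alpha> + mcoeff g \<alpha>"
  "mcoeff (f' - g') \<alpha> = mcoeff f' \<alpha> - mcoeff g' \<alpha>"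
  "mcoeff (- h) \<alpha> = - mcoeff h \<alpha>"
  by (simp_all add: zero_mfps_def plus_mfps_def minus_mfps_def uminus_mfps_def)

lemma mcoeff_one: "mcoeff 1 \<alpha> = (if \<alpha> = 0 then 1 else 0)"
  by (simp add: one_mfps_def zero_fun_def)

lemma mcoeff_mult: "mcoeff (f * g) \<alpha> = (\<Sum>\<beta> | \<beta> \<le> \<alpha>. mcoeff f \<beta> * mcoeff g (\<alpha> - \<beta>))"
  by (simp add: times_mfps_def)

lemma exponent_diff:
  fixes \<alpha> \<beta> \<gamma> :: "'v \<Rightarrow> nat"
  shows "\<beta> + \<gamma> - \<beta> = \<gamma>" "\<beta> \<le> \<beta> + \<gamma>" "\<gamma> \<le> \<beta> + \<gamma>" "\<beta> \<le> \<alpha> \<Longrightarrow> \<beta> + (\<alpha> - \<beta>) = \<alpha>"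
  by (auto simp: le_fun_def fun_eq_iff)

lemma mcoeff_mult_pairs:
  "mcoeff (f * g) \<alpha> = (\<Sum>(\<beta>, \<gamma>) | \<beta> + \<gamma> = \<alpha>. mcoeff f \<beta> * mcoeff g \<gamma>)"
  unfolding mcoeff_mult
proof (rule sum.reindex_bij_witness[of _ fst "\<lambda>\<beta>. (\<beta>, \<alpha> - \<beta>)"])
  fix p assume "p \<in> {(\<beta>, \<gamma>). \<beta> + \<gamma> = \<alpha>}"
  then obtain \<beta> \<gamma> where p: "p = (\<beta>, \<gamma>)" "\<alpha> = \<beta> + \<gamma>" by blast
  show "fst p \<in> {\<beta>. \<beta> \<le> \<alpha>}" "(fst p, \<alpha> - fst p) = p"
    unfolding p by (simp_all only: fst_conv mem_Collect_eq exponent_diff)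
qed (simp_all only: fst_conv mem_Collect_eq exponent_diff case_prod_conv)

lemma finite_exponent_pairs [simp]: "finite {(\<beta>, \<gamma>). \<beta> + \<gamma> = (\<alpha> :: 'v::finite \<Rightarrow> nat)}"
proof (rule finite_subset)
  show "{(\<beta>, \<gamma>). \<beta> + \<gamma> = \<alpha>} \<subseteq> {\<beta>. \<beta> \<le> \<alpha>} \<times> {\<beta>. \<beta> \<le> \<alpha>}"
    using exponent_diff(2,3) by blast
qed (simp only: finite_SigmaI finite_atMost_exponent)

lemma mfps_mult_assoc: "(f * g) * h = f * (g * (h :: ('v::finite, 'a::semiring_0) mfps))"
proof -
  have "mcoeff ((f * g) * h) \<alpha> = mcoeff (f * (g * h)) \<alpha>" for \<alpha>
  proof -
    have "mcoeff ((f * g) * h) \<alpha> =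
      (\<Sum>p | fst p + snd p = \<alpha>. \<Sum>q | fst q + snd q = fst p.
         mcoeff f (fst q) * mcoeff g (snd q) * mcoeff h (snd p))"
      by (simp add: mcoeff_mult_pairs case_prod_unfold sum_distrib_right)
    also have "\<dots> = (\<Sum>(p, q)\<in>(SIGMA p:{p. fst p + snd p = \<alpha>}. {q. fst q + snd q = fst p}).
         mcoeff f (fst q) * mcoeff g (snd q) * mcoeff h (snd p))"
      using finite_exponent_pairs by (subst sum.Sigma) (auto simp: case_prod_unfold)
    also have "\<dots> = (\<Sum>(p, q)\<in>(SIGMA p:{p. fst p + snd p = \<alpha>}. {q. fst q + snd q = snd p}).
         mcoeff f (fst p) * (mcoeff g (fst q) * mcoeff h (snd q)))"
      by (rule sum.reindex_bij_witness
            [of _ "\<lambda>(p, q). ((fst p + fst q, snd q), (fst p, fst q))"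
                  "\<lambda>(p, q). ((fst q, snd q + snd p), (snd q, snd p))"])
         (auto simp: add.assoc mult.assoc)
    also have "\<dots> = (\<Sum>p | fst p + snd p = \<alpha>. \<Sum>q | fst q + snd q = snd p.
         mcoeff f (fst p) * (mcoeff g (fst q) * mcoeff h (snd q)))"
      using finite_exponent_pairs by (subst sum.Sigma) (auto simp: case_prod_unfold)
    also have "\<dots> = mcoeff (f * (g * h)) \<alpha>"
      by (simp add: mcoeff_mult_pairs case_prod_unfold sum_distrib_left)
    finally show ?thesis .
  qed
  thus ?thesis by (simp add: mfps_eq_iff)
qed

lemma mfps_mult_commute: "f * g = g * (f :: ('v::finite, 'a::comm_semiring_0) mfps)"
proof -
  have "mcoeff (f * g) \<alpha> = mcoeff (g * f) \<alpha>" for \<alpha>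
    unfolding mcoeff_mult_pairs
    by (rule sum.reindex_bij_witness[of _ prod.swap prod.swap])
       (auto simp: add.commute mult.commute)
  thus ?thesis by (simp add: mfps_eq_iff)
qed

lemma mfps_one_mult: "1 * f = (f :: ('v::finite, 'a::comm_semiring_1) mfps)"
proof -
  have "mcoeff (1 * f) \<alpha> = mcoeff f \<alpha>" for \<alpha>
  proof -
    have "mcoeff (1 * f) \<alpha> = (\<Sum>\<beta> | \<beta> \<le> \<alpha>. if \<beta> = 0 then mcoeff f (\<alpha> - \<beta>) else 0)"
      unfolding mcoeff_mult by (rule sum.cong) (auto simp: mcoeff_one)
    also have "\<dots> = mcoeff f (\<alpha> - 0)"
      by (subst sum.delta, rule finite_atMost_exponent) (simp add: le_fun_def)
    also have "\<alpha> - 0 = \<alpha>"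
      by (simp add: fun_eq_iff)
    finally show ?thesis .
  qed
  thus ?thesis by (simp add: mfps_eq_iff)
qed

instance mfps :: (finite, comm_ring_1) comm_ring_1
proof
  fix f g h :: "('a, 'b) mfps"
  show "f * g * h = f * (g * h)" by (rule mfps_mult_assoc)
  show "f * g = g * f" by (rule mfps_mult_commute)
  show "1 * f = f" by (rule mfps_one_mult)
  show "(f + g) * h = f * h + g * h"
    by (simp add: mfps_eq_iff mcoeff_mult distrib_right sum.distrib)
  show "0 \<noteq> (1 :: ('a, 'b) mfps)"
    by (auto simp: mfps_eq_iff mcoeff_one)
qed (simp_all add: mfps_eq_iff algebra_simps)

lemma exists_extremal_exponents:
  fixes A B :: "('v \<Rightarrow> nat) set"
  assumes "finite V" "A \<noteq> {}" "B \<noteq> {}"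
  shows "\<exists>a\<in>A. \<exists>b\<in>B. \<forall>a'\<in>A. \<forall>b'\<in>B. (\<forall>i\<in>V. a' i + b' i = a i + b i) \<longrightarrow>
           (\<forall>i\<in>V. a' i = a i \<and> b' i = b i)"
  using assms
proof (induction V arbitrary: A B rule: finite_induct)
  case empty
  thus ?case by blast
next
  case (insert v V)
  define k where "k = (LEAST k. \<exists>a\<in>A. a v = k)"
  define l where "l = (LEAST k. \<exists>b\<in>B. b v = k)"
  have kA: "\<exists>a\<in>A. a v = k"
    unfolding k_def by (rule LeastI_ex) (use insert.prems(1) in blast)
  have lB: "\<exists>b\<in>B. b v = l"
    unfolding l_def by (rule LeastI_ex) (use insert.prems(2) in blast)
  have k: "k \<le> a v" if "a \<in> A" for a
    unfolding k_def by (rule Least_le) (use that in blast)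
  have l: "l \<le> b v" if "b \<in> B" for b
    unfolding l_def by (rule Least_le) (use that in blast)
  let ?A = "{a \<in> A. a v = k}" and ?B = "{b \<in> B. b v = l}"
  have "?A \<noteq> {}" "?B \<noteq> {}" using kA lB by blast+
  from insert.IH[OF this] obtain a b where ab: "a \<in> ?A" "b \<in> ?B" and
    *: "\<forall>a'\<in>?A. \<forall>b'\<in>?B. (\<forall>i\<in>V. a' i + b' i = a i + b i) \<longrightarrow>
           (\<forall>i\<in>V. a' i = a i \<and> b' i = b i)"
    by (elim bexE) (rule that)
  have "\<forall>i\<in>insert v V. a' i = a i \<and> b' i = b i"
    if "a' \<in> A" "b' \<in> B" "\<forall>i\<in>insert v V. a' i + b' i = a i + b i" for a' b'
  proof -
    have "a' v + b' v = k + l" using that(3) ab by simp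
    with k[OF that(1)] l[OF that(2)] have v: "a' v = k" "b' v = l" by linarith+
    hence "\<forall>i\<in>V. a' i = a i \<and> b' i = b i"
      using * that by blast
    thus ?thesis using v ab by simp
  qed
  moreover have "a \<in> A" "b \<in> B" using ab by simp_all
  ultimately show ?case by blast
qed

instance mfps :: (finite, idom) idom
proof
  fix f g :: "('a, 'b) mfps"
  assume "f \<noteq> 0" "g \<noteq> 0"
  then have "{a. mcoeff f a \<noteq> 0} \<noteq> {}" "{a. mcoeff g a \<noteq> 0} \<noteq> {}"
    unfolding mfps_eq_iff mcoeff_simps by blast+
  hence "\<exists>a\<in>{a. mcoeff f a \<noteq> 0}. \<exists>b\<in>{a. mcoeff g a \<noteq> 0}.
           \<forall>a'\<in>{a. mcoeff f a \<noteq> 0}. \<forall>b'\<in>{a. mcoeff g a \<noteq> 0}.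
           (\<forall>i\<in>UNIV. a' i + b' i = a i + b i) \<longrightarrow> (\<forall>i\<in>UNIV. a' i = a i \<and> b' i = b i)"
    by (intro exists_extremal_exponents finite_UNIV)
  then obtain a b where ab: "a \<in> {a. mcoeff f a \<noteq> 0}" "b \<in> {a. mcoeff g a \<noteq> 0}" and
    ex: "\<forall>a'\<in>{a. mcoeff f a \<noteq> 0}. \<forall>b'\<in>{a. mcoeff g a \<noteq> 0}.
           (\<forall>i\<in>UNIV. a' i + b' i = a i + b i) \<longrightarrow> (\<forall>i\<in>UNIV. a' i = a i \<and> b' i = b i)"
    by (elim bexE) (rule that)
  have *: "a' = a \<and> b' = b" if "mcoeff f a' \<noteq> 0" "mcoeff g b' \<noteq> 0" "a' + b' = a + b" for a' b'
  proof -
    have "\<forall>i\<in>UNIV. a' i + b' i = a i + b i"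
      using that(3) by (simp only: plus_fun_apply[symmetric] simp_thms ball_simps)
    hence "\<forall>i\<in>UNIV. a' i = a i \<and> b' i = b i"
      using ex that(1,2) by blast
    thus ?thesis by (intro conjI ext) blast+
  qed
  have "mcoeff (f * g) (a + b) = (\<Sum>(\<beta>, \<gamma>)\<in>{(a, b)}. mcoeff f \<beta> * mcoeff g \<gamma>)"
    unfolding mcoeff_mult_pairs
  proof (rule sum.mono_neutral_right)
    show "\<forall>p\<in>{(\<beta>, \<gamma>). \<beta> + \<gamma> = a + b} - {(a, b)}. (case p of (\<beta>, \<gamma>) \<Rightarrow> mcoeff f \<beta> * mcoeff g \<gamma>) = 0"
    proof
      fix p assume "p \<in> {(\<beta>, \<gamma>). \<beta> + \<gamma> = a + b} - {(a, b)}"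
      then obtain \<beta> \<gamma> where p: "p = (\<beta>, \<gamma>)" "\<beta> + \<gamma> = a + b" "\<not> (\<beta> = a \<and> \<gamma> = b)"
        by blast
      hence "mcoeff f \<beta> = 0 \<or> mcoeff g \<gamma> = 0" using *[of \<beta> \<gamma>] by blast
      thus "(case p of (\<beta>, \<gamma>) \<Rightarrow> mcoeff f \<beta> * mcoeff g \<gamma>) = 0"
        by (auto simp only: p case_prod_conv mult_zero_left mult_zero_right)
    qed
  qed (rule finite_exponent_pairs, blast)
  also have "\<dots> \<noteq> 0"
    using ab by (simp only: sum.insert finite.emptyI empty_iff sum.empty case_prod_conv
      mem_Collect_eq add_0_right no_zero_divisors not_False_eq_True)
  finally have "mcoeff (f * g) (a + b) \<noteq> mcoeff 0 (a + b)" by (simp only: mcoeff_simps not_False_eq_True)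
  thus "f * g \<noteq> 0" by (rule contrapos_nn) (rule arg_cong)
qed

definition mconst :: "'a::zero \<Rightarrow> ('v, 'a) mfps" where
  "mconst c = MFPS (\<lambda>\<alpha>. if \<alpha> = (\<lambda>_. 0) then c else 0)"

definition mderiv :: "'v \<Rightarrow> ('v, 'a::semiring_1) mfps \<Rightarrow> ('v, 'a) mfps" where
  "mderiv i f = MFPS (\<lambda>\<alpha>. of_nat (Suc (\<alpha> i)) * mcoeff f (\<alpha>(i := Suc (\<alpha> i))))"

lemma mcoeff_mderiv:
  "mcoeff (mderiv i f) \<alpha> = of_nat (Suc (\<alpha> i)) * mcoeff f (\<alpha>(i := Suc (\<alpha> i)))"
  by (simp add: mderiv_def)

lemma mderiv_mult:
  fixes f g :: "('v::finite, 'a::comm_ring_1) mfps"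
  shows "mderiv i (f * g) = mderiv i f * g + f * mderiv i g"
proof -
  have "mcoeff (mderiv i (f * g)) \<alpha> = mcoeff (mderiv i f * g + f * mderiv i g) \<alpha>" for \<alpha>
  proof -
    define e where "e \<beta> = \<beta>(i := Suc (\<beta> i))" for \<beta> :: "'v \<Rightarrow> nat"
    let ?S = "{p. fst p + snd p = e \<alpha>}"
    have fin: "finite ?S"
      using finite_exponent_pairs[of "e \<alpha>"] by (simp add: case_prod_unfold)
    define d where "d \<beta> = \<beta>(i := \<beta> i - 1)" for \<beta> :: "'v \<Rightarrow> nat"
    have de: "d (e \<beta>) = \<beta>" for \<beta>
      by (simp add: e_def d_def)
    have ed: "e (d \<beta>) = \<beta>" if "\<beta> i \<noteq> 0" for \<beta>
      using that by (simp add: e_def d_def)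
    have e_add: "e \<beta> + \<gamma> = e (\<beta> + \<gamma>)" "\<beta> + e \<gamma> = e (\<beta> + \<gamma>)" for \<beta> \<gamma>
      by (rule ext, simp add: e_def)+
    have d_add: "d \<beta> + \<gamma> = \<alpha>" if "\<beta> i \<noteq> 0" "\<beta> + \<gamma> = e \<alpha>" for \<beta> \<gamma>
    proof -
      have "e (d \<beta> + \<gamma>) = e \<alpha>"
        by (simp only: e_add(1)[symmetric] ed[of \<beta>, OF that(1)] that(2))
      hence "d (e (d \<beta> + \<gamma>)) = d (e \<alpha>)" by (rule arg_cong)
      thus "d \<beta> + \<gamma> = \<alpha>" by (simp only: de)
    qed
    have d_add': "\<beta> + d \<gamma> = \<alpha>" if "\<gamma> i \<noteq> 0" "\<beta> + \<gamma> = e \<alpha>" for \<beta> \<gamma>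
    proof -
      have "\<gamma> + \<beta> = e \<alpha>" using that(2) by (subst add.commute)
      from d_add[OF that(1) this] show ?thesis by (subst add.commute)
    qed
    have e_i: "e \<beta> i = Suc (\<beta> i)" for \<beta>
      by (simp add: e_def)
    have 1: "mcoeff (mderiv i f * g) \<alpha> =
        (\<Sum>p\<in>?S. of_nat (fst p i) * (mcoeff f (fst p) * mcoeff g (snd p)))"
    proof -
      have "mcoeff (mderiv i f * g) \<alpha> = (\<Sum>p | fst p + snd p = \<alpha>.
              of_nat (e (fst p) i) * (mcoeff f (e (fst p)) * mcoeff g (snd p)))"
        by (simp add: mcoeff_mult_pairs case_prod_unfold mcoeff_mderiv e_def mult.assoc)
      also have "\<dots> = (\<Sum>p | p \<in> ?S \<and> fst p i \<noteq> 0.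
              of_nat (fst p i) * (mcoeff f (fst p) * mcoeff g (snd p)))"
        by (rule sum.reindex_bij_witness
              [of _ "\<lambda>p. (d (fst p), snd p)" "\<lambda>p. (e (fst p), snd p)"])
           (simp_all add: de ed e_i e_add d_add)
      also have "\<dots> = (\<Sum>p\<in>?S. of_nat (fst p i) * (mcoeff f (fst p) * mcoeff g (snd p)))"
        using fin by (intro sum.mono_neutral_left) auto
      finally show ?thesis .
    qed
    have 2: "mcoeff (f * mderiv i g) \<alpha> =
        (\<Sum>p\<in>?S. of_nat (snd p i) * (mcoeff f (fst p) * mcoeff g (snd p)))"
    proof -
      have "mcoeff (f * mderiv i g) \<alpha> = (\<Sum>p | fst p + snd p = \<alpha>.
              of_nat (e (snd p) i) * (mcoeff f (fst p) * mcoeff g (e (snd p))))"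
        by (simp add: mcoeff_mult_pairs case_prod_unfold mcoeff_mderiv e_def algebra_simps)
      also have "\<dots> = (\<Sum>p | p \<in> ?S \<and> snd p i \<noteq> 0.
              of_nat (snd p i) * (mcoeff f (fst p) * mcoeff g (snd p)))"
        by (rule sum.reindex_bij_witness
              [of _ "\<lambda>p. (fst p, d (snd p))" "\<lambda>p. (fst p, e (snd p))"])
           (simp_all add: de ed e_i e_add d_add')
      also have "\<dots> = (\<Sum>p\<in>?S. of_nat (snd p i) * (mcoeff f (fst p) * mcoeff g (snd p)))"
        using fin by (intro sum.mono_neutral_left) auto
      finally show ?thesis .
    qed
    have "mcoeff (mderiv i f * g + f * mderiv i g) \<alpha> =
        (\<Sum>p\<in>?S. of_nat (fst p i + snd p i) * (mcoeff f (fst p) * mcoeff g (snd p)))"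
      by (simp add: 1 2 sum.distrib[symmetric] distrib_right)
    also have "\<dots> = (\<Sum>p\<in>?S. of_nat (Suc (\<alpha> i)) * (mcoeff f (fst p) * mcoeff g (snd p)))"
    proof (rule sum.cong)
      fix p assume "p \<in> ?S"
      hence "(fst p + snd p) i = e \<alpha> i" by simp
      hence "fst p i + snd p i = Suc (\<alpha> i)" by (simp add: e_i)
      thus "of_nat (fst p i + snd p i) * (mcoeff f (fst p) * mcoeff g (snd p)) =
            of_nat (Suc (\<alpha> i)) * (mcoeff f (fst p) * mcoeff g (snd p))"
        by simp
    qed simp
    also have "\<dots> = mcoeff (mderiv i (f * g)) \<alpha>"
      by (simp add: mcoeff_mderiv mcoeff_mult_pairs case_prod_unfold e_def sum_distrib_left)
    finally show ?thesis ..
  qed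
  thus ?thesis by (simp add: mfps_eq_iff)
qed


section \<open>The fraction field and its partial derivatives\<close>

text \<open>The quotient rule; \<open>fderiv_Fract\<close> shows that the choice of the representing fraction is
  irrelevant.\<close>

definition fderiv :: "'v::finite \<Rightarrow> ('v, 'a::idom) mfps fract \<Rightarrow> ('v, 'a) mfps fract" where
  "fderiv i q = (let (a, b) = (SOME (a, b). b \<noteq> 0 \<and> q = Fract a b)
     in Fract (mderiv i a * b - a * mderiv i b) (b * b))"

lemma fderiv_Fract:
  assumes "b \<noteq> 0"
  shows "fderiv i (Fract a b) = Fract (mderiv i a * b - a * mderiv i b) (b * b)"
proof -
  define p where "p = (SOME (a', b'). b' \<noteq> 0 \<and> Fract a b = Fract a' b')"
  obtain c d where cd: "p = (c, d)" by (cases p)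
  have "case p of (a', b') \<Rightarrow> b' \<noteq> 0 \<and> Fract a b = Fract a' b'"
    unfolding p_def by (rule someI[of _ "(a, b)"]) (use assms in auto)
  hence d: "d \<noteq> 0" and eq: "a * d = c * b"
    using assms by (auto simp: cd eq_fract)
  have "mderiv i (a * d) = mderiv i (c * b)" using eq by simp
  hence *: "mderiv i a * d + a * mderiv i d = mderiv i c * b + c * mderiv i b"
    by (simp add: mderiv_mult)
  have "(mderiv i a * b - a * mderiv i b) * (d * d) - (mderiv i c * d - c * mderiv i d) * (b * b)
        = b * d * ((mderiv i a * d + a * mderiv i d) - (mderiv i c * b + c * mderiv i b))
          - (a * d - c * b) * (b * mderiv i d + d * mderiv i b)"
    by (simp add: algebra_simps)
  also have "\<dots> = 0" using * eq by simp
  finally have "Fract (mderiv i a * b - a * mderiv i b) (b * b) =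
                Fract (mderiv i c * d - c * mderiv i d) (d * d)"
    using assms d by (simp add: eq_fract)
  moreover have "fderiv i (Fract a b) = Fract (mderiv i c * d - c * mderiv i d) (d * d)"
    unfolding fderiv_def p_def[symmetric] cd by simp
  ultimately show ?thesis by simp
qed

definition fconst :: "'a::idom \<Rightarrow> ('v::finite, 'a) mfps fract" where
  "fconst c = Fract (mconst c) 1"


section \<open>Linear differential operators\<close>

text \<open>The index type \<^typ>\<open>'n\<close> stands for \<open>{1, \<dots>, n}\<close> and the type \<^typ>\<open>'v\<close> of variables for
  \<open>{1, \<dots>, n + m'}\<close>; the injection \<open>\<iota>\<close> picks out the variables with respect to which one
  differentiates, so that \<open>m' = CARD('v) - CARD('n)\<close>, which may be zero.  Operators are
  represented by the maps they induce on the fraction field; their product is \<open>(\<circ>)\<close>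
  (not the pointwise product of functions), while \<open>+\<close> and \<open>0\<close> are the pointwise ones.\<close>

definition dpow ::
  "('n::finite \<Rightarrow> 'v::finite) \<Rightarrow> ('n \<Rightarrow> nat) \<Rightarrow> ('v, 'a::idom) mfps fract \<Rightarrow> ('v, 'a) mfps fract"
  where "dpow \<iota> \<alpha> = Finite_Set.fold (\<lambda>i D. (fderiv (\<iota> i) ^^ \<alpha> i) \<circ> D) id UNIV"

definition diffop ::
  "('n::finite \<Rightarrow> 'v::finite) \<Rightarrow> (('n \<Rightarrow> nat) \<Rightarrow> ('v, 'a::idom) mfps fract) \<Rightarrow>
    ('v, 'a) mfps fract \<Rightarrow> ('v, 'a) mfps fract"
  where "diffop \<iota> p = (\<lambda>f. \<Sum>\<alpha> | p \<alpha> \<noteq> 0. p \<alpha> * dpow \<iota> \<alpha> f)"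

definition diffops ::
  "('n::finite \<Rightarrow> 'v::finite) \<Rightarrow> ('v, 'a::idom) mfps fract set \<Rightarrow>
    (('v, 'a) mfps fract \<Rightarrow> ('v, 'a) mfps fract) set"
  where "diffops \<iota> H = {diffop \<iota> p | p. finite {\<alpha>. p \<alpha> \<noteq> 0} \<and> range p \<subseteq> H}"

text \<open>The coefficients of an operator are unique by \<open>diffop_unique\<close> below.\<close>

definition dcoeff ::
  "('n::finite \<Rightarrow> 'v::finite) \<Rightarrow> (('v, 'a::idom) mfps fract \<Rightarrow> ('v, 'a) mfps fract) \<Rightarrow>
    ('n \<Rightarrow> nat) \<Rightarrow> ('v, 'a) mfps fract"
  where "dcoeff \<iota> P = (THE p. finite {\<alpha>. p \<alpha> \<noteq> 0} \<and> P = diffop \<iota> p)"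

lemma mderiv_one: "mderiv i 1 = 0"
proof -
  have "\<alpha>(i := Suc (\<alpha> i)) \<noteq> 0" for \<alpha>
  proof
    assume "\<alpha>(i := Suc (\<alpha> i)) = 0"
    hence "(\<alpha>(i := Suc (\<alpha> i))) i = 0 i" by (rule arg_cong)
    thus False by simp
  qed
  thus ?thesis by (simp add: mfps_eq_iff mcoeff_mderiv mcoeff_one)
qed

lemma fderiv_embed: "fderiv i (Fract f 1) = Fract (mderiv i f) 1"
  by (simp add: fderiv_Fract mderiv_one)

lemma mderiv_add: "mderiv i (f + g) = mderiv i f + mderiv i g"
  by (simp add: mfps_eq_iff mcoeff_mderiv algebra_simps)

lemma fderiv_mult: "fderiv i (p * q) = fderiv i p * q + p * fderiv i q"
proof -
  obtain a b where p: "p = Fract a b" "b \<noteq> 0" by (cases p)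
  obtain c d where q: "q = Fract c d" "d \<noteq> 0" by (cases q)
  show ?thesis
    using p(2) q(2)
    by (simp add: p(1) q(1) fderiv_Fract eq_fract mderiv_mult) (simp add: algebra_simps)
qed

lemma fderiv_add: "fderiv i (p + q) = fderiv i p + fderiv i q"
proof -
  obtain a b where p: "p = Fract a b" "b \<noteq> 0" by (cases p)
  obtain c d where q: "q = Fract c d" "d \<noteq> 0" by (cases q)
  show ?thesis
    using p(2) q(2)
    by (simp add: p(1) q(1) fderiv_Fract eq_fract mderiv_mult mderiv_add)
       (simp add: algebra_simps)
qed

lemma mderiv_commute: "mderiv i (mderiv j f) = mderiv j (mderiv i f)"
proof (cases "i = j")
  case False
  thus ?thesis
    by (simp add: mfps_eq_iff mcoeff_mderiv fun_upd_twist[of i j] mult.left_commute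
             del: of_nat_Suc)
       (metis (no_types, lifting) mult.assoc mult_of_nat_commute)
qed simp

lemma fderiv_commute: "fderiv i (fderiv j q) = fderiv j (fderiv i q)"
proof -
  obtain a b where q: "q = Fract a b" "b \<noteq> 0" by (cases q)
  define B where "B = Fract b 1"
  have B: "B \<noteq> 0" using q by (simp add: B_def Zero_fract_def eq_fract)
  have qB: "q * B = Fract a 1"
    using q by (simp add: B_def eq_fract)
  have "fderiv i (fderiv j (q * B)) = fderiv j (fderiv i (q * B))"
    by (simp add: qB fderiv_embed mderiv_commute)
  moreover have "fderiv i (fderiv j B) = fderiv j (fderiv i B)"
    by (simp add: B_def fderiv_embed mderiv_commute)
  ultimately have "fderiv i (fderiv j q) * B = fderiv j (fderiv i q) * B"
    by (simp add: fderiv_mult fderiv_add)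
  thus ?thesis using B by simp
qed

lemma fderiv_pow_commute:
  "(fderiv i ^^ k) ((fderiv j ^^ l) q) = (fderiv j ^^ l) ((fderiv i ^^ k) q)"
proof -
  have 1: "fderiv i ((fderiv j ^^ l) q) = (fderiv j ^^ l) (fderiv i q)" for q
    by (induction l) (simp_all add: fderiv_commute[of i j])
  show ?thesis
    by (induction k) (simp_all add: 1)
qed

lemma dpow_comp_fun_commute:
  "comp_fun_commute_on UNIV (\<lambda>i D. (fderiv (\<iota> i) ^^ \<alpha> i) \<circ> D)"
  by unfold_locales (auto simp: fun_eq_iff fderiv_pow_commute)

lemma mcoeff_mderiv_pow:
  fixes f :: "('v, 'a::comm_semiring_1) mfps"
  shows "\<exists>c>0. mcoeff ((mderiv i ^^ k) f) \<gamma> = of_nat c * mcoeff f (\<gamma>(i := \<gamma> i + k))"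
proof (induction k arbitrary: \<gamma>)
  case 0
  show ?case by (intro exI[of _ 1]) simp
next
  case (Suc k)
  obtain c where "c > 0" and c: "mcoeff ((mderiv i ^^ k) f) (\<gamma>(i := Suc (\<gamma> i))) =
      of_nat c * mcoeff f (\<gamma>(i := Suc (\<gamma> i) + k))"
    using Suc.IH[of "\<gamma>(i := Suc (\<gamma> i))"] unfolding fun_upd_upd fun_upd_same by blast
  have "mcoeff ((mderiv i ^^ Suc k) f) \<gamma> =
      of_nat (Suc (\<gamma> i) * c) * mcoeff f (\<gamma>(i := \<gamma> i + Suc k))"
    by (simp add: mcoeff_mderiv c algebra_simps)
  moreover have "Suc (\<gamma> i) * c > 0" using \<open>c > 0\<close> by simp
  ultimately show ?case by blast
qed

lemma dpow_embed:
  fixes \<iota> :: "'n::finite \<Rightarrow> 'v::finite" and f :: "('v, 'a::idom) mfps"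
  shows "\<exists>g. dpow \<iota> \<alpha> (Fract f 1) = Fract g 1 \<and>
    (\<forall>\<gamma>. \<exists>c>0. mcoeff g \<gamma> = of_nat c * mcoeff f (\<lambda>v. \<gamma> v + (\<Sum>i | \<iota> i = v. \<alpha> i)))"
proof -
  interpret comp_fun_commute_on UNIV
    "\<lambda>i D. (fderiv (\<iota> i) ^^ \<alpha> i) \<circ> (D :: ('v, 'a) mfps fract \<Rightarrow> ('v, 'a) mfps fract)"
    by (rule dpow_comp_fun_commute)
  have "\<exists>g. Finite_Set.fold (\<lambda>i D. (fderiv (\<iota> i) ^^ \<alpha> i) \<circ> D) id A (Fract f 1) = Fract g 1 \<and>
    (\<forall>\<gamma>. \<exists>c>0. mcoeff g \<gamma> = of_nat c * mcoeff f (\<lambda>v. \<gamma> v + (\<Sum>i | i \<in> A \<and> \<iota> i = v. \<alpha> i)))"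
    if "finite A" for A
    using that
  proof (induction A rule: finite_induct)
    case empty
    show ?case by (intro exI[of _ f] conjI allI exI[of _ "1 :: nat"]) simp_all
  next
    case (insert j A)
    from insert.IH obtain g where
      g: "Finite_Set.fold (\<lambda>i D. (fderiv (\<iota> i) ^^ \<alpha> i) \<circ> D) id A (Fract f 1) = Fract g 1" and
      gc: "\<And>\<gamma>. \<exists>c>0. mcoeff g \<gamma> =
             of_nat c * mcoeff f (\<lambda>v. \<gamma> v + (\<Sum>i | i \<in> A \<and> \<iota> i = v. \<alpha> i))"
      by (elim exE conjE) (rule that, assumption, erule spec)
    have pow: "(fderiv i ^^ k) (Fract h 1) = Fract ((mderiv i ^^ k) h) 1"
      for i :: 'v and k and h :: "('v, 'a) mfps"
      by (induction k) (simp_all add: fderiv_embed)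
    show ?case
    proof (intro exI[of _ "(mderiv (\<iota> j) ^^ \<alpha> j) g"] conjI allI)
      show "Finite_Set.fold (\<lambda>i D. (fderiv (\<iota> i) ^^ \<alpha> i) \<circ> D) id (insert j A) (Fract f 1) =
            Fract ((mderiv (\<iota> j) ^^ \<alpha> j) g) 1"
        using insert.hyps by (subst fold_insert) (simp_all add: g pow)
      fix \<gamma>
      let ?\<gamma> = "\<gamma>(\<iota> j := \<gamma> (\<iota> j) + \<alpha> j)"
      obtain c where c: "c > 0"
        "mcoeff ((mderiv (\<iota> j) ^^ \<alpha> j) g) \<gamma> = of_nat c * mcoeff g ?\<gamma>"
        using mcoeff_mderiv_pow[where i = "\<iota> j" and k = "\<alpha> j" and f = g and \<gamma> = \<gamma>]
        by (elim exE conjE) (rule that)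
      obtain c' where c': "c' > 0"
        "mcoeff g ?\<gamma> = of_nat c' * mcoeff f (\<lambda>v. ?\<gamma> v + (\<Sum>i | i \<in> A \<and> \<iota> i = v. \<alpha> i))"
        using gc[of ?\<gamma>] by (elim exE conjE) (rule that)
      have "?\<gamma> v + (\<Sum>i | i \<in> A \<and> \<iota> i = v. \<alpha> i) =
            \<gamma> v + (\<Sum>i | i \<in> insert j A \<and> \<iota> i = v. \<alpha> i)" for v
      proof (cases "\<iota> j = v")
        case True
        hence "{i. i \<in> insert j A \<and> \<iota> i = v} = insert j {i. i \<in> A \<and> \<iota> i = v}" by blast
        thus ?thesis using True insert.hyps by (simp del: insert_iff)
      next
        case False
        hence "{i. i \<in> insert j A \<and> \<iota> i = v} = {i. i \<in> A \<and> \<iota> i = v}" by blast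
        thus ?thesis using False by (simp del: insert_iff)
      qed
      hence eq: "(\<lambda>v. ?\<gamma> v + (\<Sum>i | i \<in> A \<and> \<iota> i = v. \<alpha> i)) =
            (\<lambda>v. \<gamma> v + (\<Sum>i | i \<in> insert j A \<and> \<iota> i = v. \<alpha> i))"
        by (rule ext)
      have "mcoeff ((mderiv (\<iota> j) ^^ \<alpha> j) g) \<gamma> =
          of_nat (c * c') * mcoeff f (\<lambda>v. \<gamma> v + (\<Sum>i | i \<in> insert j A \<and> \<iota> i = v. \<alpha> i))"
        unfolding c(2) c'(2) eq of_nat_mult by (rule mult.assoc[symmetric])
      moreover have "c * c' > 0" using c c' by simp
      ultimately show "\<exists>c>0. mcoeff ((mderiv (\<iota> j) ^^ \<alpha> j) g) \<gamma> =
          of_nat c * mcoeff f (\<lambda>v. \<gamma> v + (\<Sum>i | i \<in> insert j A \<and> \<iota> i = v. \<alpha> i))"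
        by (intro exI[of _ "c * c'"] conjI)
    qed
  qed
  from this[OF finite_UNIV] show ?thesis
    unfolding dpow_def by (simp only: UNIV_I simp_thms)
qed

lemma diffop_eq_0D:
  fixes \<iota> :: "'n::finite \<Rightarrow> 'v::finite"
    and p :: "('n \<Rightarrow> nat) \<Rightarrow> ('v, 'a::{idom, ring_char_0}) mfps fract"
  assumes "inj \<iota>" "finite {\<alpha>. p \<alpha> \<noteq> 0}" "diffop \<iota> p = 0"
  shows "p = 0"
proof (rule ccontr)
  assume "p \<noteq> 0"
  then obtain \<alpha>0 where "p \<alpha>0 \<noteq> 0" by (auto simp: fun_eq_iff)
  then obtain \<beta> where \<beta>: "p \<beta> \<noteq> 0" and min: "\<And>\<alpha>. p \<alpha> \<noteq> 0 \<Longrightarrow> sum \<beta> UNIV \<le> sum \<alpha> UNIV"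
    using ex_has_least_nat[of "\<lambda>\<alpha>. p \<alpha> \<noteq> 0" \<alpha>0 "\<lambda>\<alpha>. sum \<alpha> UNIV"] by auto
  define push where "push \<alpha> = (\<lambda>v. \<Sum>i | \<iota> i = v. \<alpha> i)" for \<alpha> :: "'n \<Rightarrow> nat"
  have push: "push \<alpha> (\<iota> i) = \<alpha> i" for \<alpha> i
  proof -
    have "{j. \<iota> j = \<iota> i} = {i}" using \<open>inj \<iota>\<close> by (auto dest: injD)
    thus ?thesis by (simp add: push_def)
  qed
  define x where "x = (MFPS (\<lambda>\<gamma>. if \<gamma> = push \<beta> then 1 else 0) :: ('v, 'a) mfps)"
  have "\<exists>g. dpow \<iota> \<alpha> (Fract x 1) = Fract g 1 \<and> (\<forall>\<gamma>. \<exists>c>0.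
           mcoeff g \<gamma> = of_nat c * mcoeff x (\<lambda>v. \<gamma> v + push \<alpha> v))" for \<alpha>
    unfolding push_def by (rule dpow_embed)
  then obtain g where g: "\<And>\<alpha>. dpow \<iota> \<alpha> (Fract x 1) = Fract (g \<alpha>) 1" and
    gc: "\<And>\<alpha> \<gamma>. \<exists>c>0. mcoeff (g \<alpha>) \<gamma> = of_nat c * mcoeff x (\<lambda>v. \<gamma> v + push \<alpha> v)"
    by metis
  have "g \<alpha> = 0" if "p \<alpha> \<noteq> 0" "\<alpha> \<noteq> \<beta>" for \<alpha>
  proof -
    have "(\<lambda>v. \<gamma> v + push \<alpha> v) \<noteq> push \<beta>" for \<gamma>
    proof
      assume "(\<lambda>v. \<gamma> v + push \<alpha> v) = push \<beta>"
      hence "\<gamma> (\<iota> i) + \<alpha> i = \<beta> i" for i using push by (metis (mono_tags))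
      hence le: "\<alpha> i \<le> \<beta> i" for i by (metis le_add2)
      obtain i where "\<alpha> i \<noteq> \<beta> i" using \<open>\<alpha> \<noteq> \<beta>\<close> by (auto simp: fun_eq_iff)
      with le have "sum \<alpha> UNIV < sum \<beta> UNIV"
        by (intro sum_strict_mono_ex1) (auto simp: order.strict_iff_order)
      with min[OF that(1)] show False by simp
    qed
    hence "mcoeff x (\<lambda>v. \<gamma> v + push \<alpha> v) = 0" for \<gamma>
      by (simp add: x_def)
    thus ?thesis
      using gc[of \<alpha>] by (simp add: mfps_eq_iff)
  qed
  hence zero: "p \<alpha> * dpow \<iota> \<alpha> (Fract x 1) = 0" if "\<alpha> \<in> {\<alpha>. p \<alpha> \<noteq> 0} - {\<beta>}" for \<alpha>
    using that by (simp add: g Zero_fract_def[symmetric])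
  have "0 = diffop \<iota> p (Fract x 1)" using assms by simp
  also have "\<dots> = (\<Sum>\<alpha>\<in>{\<beta>}. p \<alpha> * dpow \<iota> \<alpha> (Fract x 1))"
    unfolding diffop_def using assms(2) \<beta> zero by (intro sum.mono_neutral_right) auto
  finally have "p \<beta> * Fract (g \<beta>) 1 = 0" by (simp add: g)
  hence "Fract (g \<beta>) 1 = 0" using \<beta> by simp
  hence "g \<beta> = 0" by (simp add: Zero_fract_def eq_fract)
  moreover have "mcoeff (g \<beta>) 0 \<noteq> 0"
    using gc[of \<beta> 0] by (auto simp: x_def)
  ultimately show False by simp
qed

theorem diffop_unique:
  fixes \<iota> :: "'n::finite \<Rightarrow> 'v::finite"
    and p q :: "('n \<Rightarrow> nat) \<Rightarrow> ('v, 'a::{idom, ring_char_0}) mfps fract"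
  assumes "inj \<iota>" "finite {\<alpha>. p \<alpha> \<noteq> 0}" "finite {\<alpha>. q \<alpha> \<noteq> 0}" "diffop \<iota> p = diffop \<iota> q"
  shows "p = q"
proof -
  let ?S = "{\<alpha>. p \<alpha> \<noteq> 0} \<union> {\<alpha>. q \<alpha> \<noteq> 0}"
  define r where "r = (\<lambda>\<alpha>. p \<alpha> - q \<alpha>)"
  have sup: "{\<alpha>. r \<alpha> \<noteq> 0} \<subseteq> ?S" by (auto simp: r_def)
  have fin: "finite {\<alpha>. r \<alpha> \<noteq> 0}"
    using finite_subset[OF sup] assms by simp
  have *: "diffop \<iota> s f = (\<Sum>\<alpha>\<in>?S. s \<alpha> * dpow \<iota> \<alpha> f)" if "{\<alpha>. s \<alpha> \<noteq> 0} \<subseteq> ?S"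
    for s and f :: "('v, 'a) mfps fract"
    unfolding diffop_def using that assms by (intro sum.mono_neutral_left) auto
  have "diffop \<iota> r f = diffop \<iota> p f - diffop \<iota> q f" for f
    using sup by (subst (1 2 3) *) (auto simp: r_def sum_subtractf left_diff_distrib)
  hence "diffop \<iota> r = 0" by (simp add: fun_eq_iff assms(4))
  from diffop_eq_0D[OF assms(1) fin this] show "p = q"
    by (simp add: r_def fun_eq_iff)
qed

corollary dcoeff_diffop:
  fixes \<iota> :: "'n::finite \<Rightarrow> 'v::finite"
    and p :: "('n \<Rightarrow> nat) \<Rightarrow> ('v, 'a::{idom, ring_char_0}) mfps fract"
  assumes "inj \<iota>" "finite {\<alpha>. p \<alpha> \<noteq> 0}"
  shows "dcoeff \<iota> (diffop \<iota> p) = p"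
  unfolding dcoeff_def using assms diffop_unique[OF assms(1)] by (intro the_equality) auto


section \<open>Exponents, leading coefficients and reduction\<close>

text \<open>\<^term>\<open>None\<close> plays the role of \<open>-\<infinity>\<close>, the exponent of the zero operator.\<close>

definition dexp ::
  "('n::finite \<Rightarrow> 'v::finite) \<Rightarrow> (('n \<Rightarrow> nat) \<Rightarrow> ('n \<Rightarrow> nat) \<Rightarrow> bool) \<Rightarrow>
    (('v, 'a::idom) mfps fract \<Rightarrow> ('v, 'a) mfps fract) \<Rightarrow> ('n \<Rightarrow> nat) option"
  where "dexp \<iota> leq P =
    (if P = 0 then None else Some (linorder.Max leq {\<alpha>. dcoeff \<iota> P \<alpha> \<noteq> 0}))"

fun le_bot :: "('a \<Rightarrow> 'a \<Rightarrow> bool) \<Rightarrow> 'a option \<Rightarrow> 'a option \<Rightarrow> bool" where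
  "le_bot leq None _ \<longleftrightarrow> True"
| "le_bot leq (Some x) None \<longleftrightarrow> False"
| "le_bot leq (Some x) (Some y) \<longleftrightarrow> leq x y"

definition dlcoeff ::
  "('n::finite \<Rightarrow> 'v::finite) \<Rightarrow> (('n \<Rightarrow> nat) \<Rightarrow> ('n \<Rightarrow> nat) \<Rightarrow> bool) \<Rightarrow>
    (('v, 'a::idom) mfps fract \<Rightarrow> ('v, 'a) mfps fract) \<Rightarrow> ('v, 'a) mfps fract"
  where "dlcoeff \<iota> leq P = dcoeff \<iota> P (the (dexp \<iota> leq P))"

definition exp_cone ::
  "('n::finite \<Rightarrow> 'v::finite) \<Rightarrow> (('n \<Rightarrow> nat) \<Rightarrow> ('n \<Rightarrow> nat) \<Rightarrow> bool) \<Rightarrow>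
    (('v, 'a::idom) mfps fract \<Rightarrow> ('v, 'a) mfps fract) \<Rightarrow> ('n \<Rightarrow> nat) set"
  where "exp_cone \<iota> leq P = {\<epsilon> + \<gamma> | \<epsilon> \<gamma>. dexp \<iota> leq P = Some \<epsilon>}"

text \<open>The ring structure that a subset inherits from the ambient type.\<close>

abbreviation ring_on :: "'a::ring_1 set \<Rightarrow> 'a ring" where
  "ring_on H \<equiv> ring_of_type_algebra\<lparr>carrier := H\<rparr>"

definition lc_ideal ::
  "('n::finite \<Rightarrow> 'v::finite) \<Rightarrow> (('n \<Rightarrow> nat) \<Rightarrow> ('n \<Rightarrow> nat) \<Rightarrow> bool) \<Rightarrow>
    ('v, 'a::idom) mfps fract set \<Rightarrow> ('n \<Rightarrow> nat) \<Rightarrow>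
    (('v, 'a) mfps fract \<Rightarrow> ('v, 'a) mfps fract) set \<Rightarrow> ('v, 'a) mfps fract set"
  where "lc_ideal \<iota> leq H \<alpha> F =
    genideal (ring_on H) {dlcoeff \<iota> leq P | P. P \<in> F \<and> \<alpha> \<in> exp_cone \<iota> leq P}"

definition reduced ::
  "('n::finite \<Rightarrow> 'v::finite) \<Rightarrow> (('n \<Rightarrow> nat) \<Rightarrow> ('n \<Rightarrow> nat) \<Rightarrow> bool) \<Rightarrow>
    ('v, 'a::idom) mfps fract set \<Rightarrow> (('v, 'a) mfps fract \<Rightarrow> ('v, 'a) mfps fract) set \<Rightarrow>
    (('v, 'a) mfps fract \<Rightarrow> ('v, 'a) mfps fract) \<Rightarrow> bool"
  where "reduced \<iota> leq H F P \<longleftrightarrow>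
    P = 0 \<or>
    (\<exists>\<epsilon>. dexp \<iota> leq P = Some \<epsilon> \<and>
      (\<epsilon> \<notin> (\<Union>Q\<in>F. exp_cone \<iota> leq Q) \<or>
       (\<epsilon> \<in> (\<Union>Q\<in>F. exp_cone \<iota> leq Q) \<and> dlcoeff \<iota> leq P \<notin> lc_ideal \<iota> leq H \<epsilon> F)))"

end

theory Submission
  imports Defs
begin

text \<open>The theorem is division with remainder by cancellation of leading terms. Multiplying an operator
  \<open>X = c \<partial>\<^sup>\<epsilon> + lower terms\<close> from the left by \<open>q \<partial>\<^sup>\<gamma>\<close> gives \<open>q c \<partial>\<^sup>(\<epsilon> + \<gamma>) + lower terms\<close>: by the
  Leibniz rule, each derivative that falls on a coefficient is missing from the exponent, and the
  exponent gets smaller because \<open>0\<close> is the least element of the term order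
  (\<open>monop_comp_leading_term\<close>). Leading terms therefore multiply as if the derivations
  commuted with the coefficients.

  If \<open>P\<close> has exponent \<open>\<epsilon>\<close> and is not reduced, its leading coefficient is an \<open>H\<close>-combination of the
  leading coefficients of those \<open>P\<^sub>i\<close> that can be shifted to the exponent \<open>\<epsilon>\<close>. The same combination
  of the shifted operators has the leading term of \<open>P\<close>, and subtracting it leaves an operator of
  smaller exponent (\<open>cancel_leading_term\<close>). Since the order is a well-ordering, this ends with a
  reduced remainder, after subtracting only multiples of the \<open>P\<^sub>i\<close> whose exponents do not exceed
  \<open>\<epsilon>\<close> (\<open>division\<close>). The exponents of the \<open>Q\<^sub>i P\<^sub>i\<close> and of \<open>R\<close> are thus at most that of \<open>P\<close>, and one
  of them attains it because \<open>P\<close> is their sum (\<open>Max_dexp_summands\<close>).\<close>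

section \<open>Exponents and the term order\<close>

definition unit_exponent :: "'n \<Rightarrow> 'n \<Rightarrow> nat" where
  "unit_exponent i = (\<lambda>j. if j = i then 1 else 0)"

lemma exponent_induct [case_names zero step]:
  fixes \<alpha> :: "'n::finite \<Rightarrow> nat"
  assumes zero: "Q 0" and step: "\<And>\<alpha> i. Q \<alpha> \<Longrightarrow> Q (\<alpha> + unit_exponent i)"
  shows "Q \<alpha>"
proof (induction "sum \<alpha> UNIV" arbitrary: \<alpha>)
  case 0
  hence "\<alpha> = 0" by (simp add: fun_eq_iff)
  thus "Q \<alpha>" using zero by simp
next
  case (Suc n)
  have "\<exists>i. \<alpha> i \<noteq> 0"
  proof (rule ccontr)
    assume "\<not> (\<exists>i. \<alpha> i \<noteq> 0)"
    thus False using Suc.hyps(2) by simp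
  qed
  then obtain i where i: "\<alpha> i \<noteq> 0" by blast
  define \<beta> where "\<beta> = \<alpha>(i := \<alpha> i - 1)"
  have \<alpha>: "\<alpha> = \<beta> + unit_exponent i"
    using i by (auto simp: \<beta>_def unit_exponent_def fun_eq_iff)
  have "sum \<alpha> UNIV = sum \<beta> UNIV + 1"
    unfolding \<alpha> by (simp add: sum.distrib unit_exponent_def)
  hence "Q \<beta>" using Suc by simp
  thus ?case using step \<alpha> by metis
qed

locale term_order =
  fixes leq lt :: "('n::finite \<Rightarrow> nat) \<Rightarrow> ('n \<Rightarrow> nat) \<Rightarrow> bool"
  assumes wellorder: "class.wellorder leq lt"
    and add_right_less_iff: "\<And>\<alpha> \<beta> \<gamma>. lt (\<alpha> + \<gamma>) (\<beta> + \<gamma>) \<longleftrightarrow> lt \<alpha> \<beta>"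
begin

sublocale ord: wellorder leq lt
  by (rule wellorder)

text \<open>An exponent \<open>\<delta> < 0\<close> would give \<open>\<alpha> + \<delta> < \<alpha>\<close> for every \<open>\<alpha>\<close>, hence an infinite descent.\<close>

lemma not_less_zero: "\<not> lt \<delta> 0"
proof
  assume "lt \<delta> 0"
  hence descent: "lt (\<delta> + \<alpha>) \<alpha>" for \<alpha>
    using add_right_less_iff[of \<delta> \<alpha> 0] by simp
  have False for \<alpha> :: "'n \<Rightarrow> nat"
    by (induction \<alpha> rule: ord.less_induct) (use descent in blast)
  thus False .
qed

lemma less_add_unit: "lt \<alpha> (\<alpha> + unit_exponent i)"
proof -
  have "unit_exponent i \<noteq> 0"
    by (metis unit_exponent_def one_neq_zero zero_fun_apply)
  hence "lt 0 (unit_exponent i)"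
    using not_less_zero ord.less_linear by metis
  thus ?thesis
    using add_right_less_iff[of 0 \<alpha> "unit_exponent i"] by (simp add: add.commute)
qed

lemma linorder_le_bot:
  "class.linorder (le_bot leq) (\<lambda>x y. le_bot leq x y \<and> \<not> le_bot leq y x)"
proof
  fix x y z :: "('n \<Rightarrow> nat) option"
  show "le_bot leq x x" by (cases x) auto
  show "le_bot leq x z" if "le_bot leq x y" "le_bot leq y z"
    using that by (cases x; cases y; cases z) (auto intro: ord.order_trans)
  show "x = y" if "le_bot leq x y" "le_bot leq y x"
    using that by (cases x; cases y) auto
  show "le_bot leq x y \<or> le_bot leq y x"
    by (cases x; cases y) (auto intro: ord.linear)
qed simp

end


section \<open>Monomial operators\<close>

definition monop ::
  "('n::finite \<Rightarrow> 'v::finite) \<Rightarrow> ('v, 'a::idom) mfps fract \<Rightarrow> ('n \<Rightarrow> nat) \<Rightarrow>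
    ('v, 'a) mfps fract \<Rightarrow> ('v, 'a) mfps fract"
  where "monop \<iota> c \<alpha> = (\<lambda>f. c * dpow \<iota> \<alpha> f)"

lemma monop_0 [simp]: "monop \<iota> 0 \<alpha> = 0"
  by (simp add: monop_def fun_eq_iff)

lemma monop_add: "monop \<iota> (c + d) \<alpha> = monop \<iota> c \<alpha> + monop \<iota> d \<alpha>"
  by (simp add: monop_def fun_eq_iff distrib_right)

lemma monop_sum: "monop \<iota> (\<Sum>i\<in>I. c i) \<alpha> = (\<Sum>i\<in>I. monop \<iota> (c i) \<alpha>)"
  by (induction I rule: infinite_finite_induct) (simp_all add: monop_add)

lemma diffop_eq_sum_monop:
  assumes "finite S" "{\<alpha>. p \<alpha> \<noteq> 0} \<subseteq> S"
  shows "diffop \<iota> p = (\<Sum>\<alpha>\<in>S. monop \<iota> (p \<alpha>) \<alpha>)"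
proof
  fix f
  have "(\<Sum>\<alpha>\<in>S. monop \<iota> (p \<alpha>) \<alpha>) f = (\<Sum>\<alpha>\<in>S. p \<alpha> * dpow \<iota> \<alpha> f)"
    using assms(1) by (induction S rule: finite_induct) (simp_all add: monop_def)
  also have "\<dots> = diffop \<iota> p f"
    unfolding diffop_def using assms by (intro sum.mono_neutral_right) auto
  finally show "diffop \<iota> p f = (\<Sum>\<alpha>\<in>S. monop \<iota> (p \<alpha>) \<alpha>) f" ..
qed

lemma dpow_0:
  fixes \<iota> :: "'n::finite \<Rightarrow> 'v::finite"
  shows "dpow \<iota> 0 = (id :: ('v, 'a::idom) mfps fract \<Rightarrow> _)"
proof -
  let ?g = "\<lambda>i D. (fderiv (\<iota> i) ^^ (0 :: 'n \<Rightarrow> nat) i) \<circ>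
    (D :: ('v, 'a) mfps fract \<Rightarrow> ('v, 'a) mfps fract)"
  have "Finite_Set.fold ?g id A = id" if "finite A" for A
    using that
  proof (induction A rule: finite_induct)
    case empty
    show ?case by (rule Finite_Set.fold_empty)
  next
    case (insert j A)
    interpret comp_fun_commute_on UNIV ?g
      by (rule dpow_comp_fun_commute)
    have "Finite_Set.fold ?g id (insert j A) = ?g j (Finite_Set.fold ?g id A)"
      using insert.hyps by (intro fold_insert) auto
    also have "\<dots> = id"
      unfolding insert.IH by (simp add: fun_eq_iff)
    finally show ?case .
  qed
  thus ?thesis by (simp only: dpow_def finite_UNIV)
qed

lemma dpow_add_unit:
  fixes \<iota> :: "'n::finite \<Rightarrow> 'v::finite"
  shows "dpow \<iota> (\<alpha> + unit_exponent i) =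
    (fderiv (\<iota> i) \<circ> dpow \<iota> \<alpha> :: ('v, 'a::idom) mfps fract \<Rightarrow> _)"
proof -
  let ?g = "\<lambda>\<alpha> i D. (fderiv (\<iota> i) ^^ \<alpha> i) \<circ>
    (D :: ('v, 'a) mfps fract \<Rightarrow> ('v, 'a) mfps fract)"
  have split: "dpow \<iota> \<beta> =
      (fderiv (\<iota> i) ^^ \<beta> i) \<circ> Finite_Set.fold (?g \<beta>) id (UNIV - {i})" for \<beta>
  proof -
    interpret comp_fun_commute_on UNIV "?g \<beta>"
      by (rule dpow_comp_fun_commute)
    show ?thesis
      unfolding dpow_def by (subst fold_rec[where x = i]) auto
  qed
  have fold_eq: "Finite_Set.fold (?g (\<alpha> + unit_exponent i)) id (UNIV - {i}) =
      Finite_Set.fold (?g \<alpha>) id (UNIV - {i})"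
    by (rule Finite_Set.fold_cong[where S = UNIV])
      (auto simp: unit_exponent_def intro: dpow_comp_fun_commute)
  have exp: "(\<alpha> + unit_exponent i) i = Suc (\<alpha> i)"
    by (simp add: unit_exponent_def)
  show ?thesis
    unfolding split[of \<alpha>] split[of "\<alpha> + unit_exponent i"] fold_eq exp
    by (simp only: funpow.simps comp_assoc)
qed

lemma fderiv_0 [simp]: "fderiv i 0 = 0"
  by (metis add_cancel_left_left fderiv_add)

text \<open>The Leibniz rule. The term with the differentiated coefficient keeps the exponent \<open>\<alpha>\<close>, which is
  below \<open>\<alpha> + unit_exponent i\<close> in every term order.\<close>

lemma fderiv_comp_monop:
  "fderiv (\<iota> i) \<circ> monop \<iota> c \<alpha> =
    monop \<iota> (fderiv (\<iota> i) c) \<alpha> + monop \<iota> c (\<alpha> + unit_exponent i)"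
  by (rule ext) (simp add: monop_def fderiv_mult dpow_add_unit)

lemma fderiv_comp_add: "fderiv i \<circ> (U + Y) = (fderiv i \<circ> U) + (fderiv i \<circ> Y)"
  by (simp add: fun_eq_iff fderiv_add)


section \<open>Operators with prescribed support\<close>

text \<open>The sets \<open>supp_ops {\<alpha>. \<alpha> < \<epsilon>}\<close> and \<open>supp_ops {\<alpha>. \<alpha> \<le> \<epsilon>}\<close> form the filtration by the exponent.
  Statements about leading terms are expressed as membership of \<open>U - c \<partial>\<^sup>\<epsilon>\<close> in the former,
  which replaces calculations with coefficient families by the additivity of that set.\<close>

locale diff_coefficients =
  fixes \<iota> :: "'n::finite \<Rightarrow> 'v::finite"
    and H :: "('v, 'k::{idom, ring_char_0}) mfps fract set"
  assumes inj: "inj \<iota>"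
    and zero_in_H: "0 \<in> H"
    and add_in_H: "\<And>a b. a \<in> H \<Longrightarrow> b \<in> H \<Longrightarrow> a + b \<in> H"
    and uminus_in_H: "\<And>a. a \<in> H \<Longrightarrow> - a \<in> H"
    and mult_in_H: "\<And>a b. a \<in> H \<Longrightarrow> b \<in> H \<Longrightarrow> a * b \<in> H"
    and fderiv_in_H: "\<And>i a. a \<in> H \<Longrightarrow> fderiv (\<iota> i) a \<in> H"
begin

definition supp_ops ::
  "('n \<Rightarrow> nat) set \<Rightarrow> (('v, 'k) mfps fract \<Rightarrow> ('v, 'k) mfps fract) set" where
  "supp_ops A = {diffop \<iota> p | p. finite {\<alpha>. p \<alpha> \<noteq> 0} \<and> range p \<subseteq> H \<and> {\<alpha>. p \<alpha> \<noteq> 0} \<subseteq> A}"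

lemma supp_opsI:
  "finite {\<alpha>. p \<alpha> \<noteq> 0} \<Longrightarrow> range p \<subseteq> H \<Longrightarrow> {\<alpha>. p \<alpha> \<noteq> 0} \<subseteq> A \<Longrightarrow> diffop \<iota> p \<in> supp_ops A"
  unfolding supp_ops_def by blast

lemma supp_opsE:
  assumes "U \<in> supp_ops A"
  obtains p where "U = diffop \<iota> p" "finite {\<alpha>. p \<alpha> \<noteq> 0}" "range p \<subseteq> H" "{\<alpha>. p \<alpha> \<noteq> 0} \<subseteq> A"
  using assms unfolding supp_ops_def by blast

lemma diffops_eq_supp_ops: "diffops \<iota> H = supp_ops UNIV"
  by (simp add: diffops_def supp_ops_def)

lemma supp_ops_mono: "A \<subseteq> B \<Longrightarrow> U \<in> supp_ops A \<Longrightarrow> U \<in> supp_ops B"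
  unfolding supp_ops_def by blast

lemma zero_in_supp_ops: "0 \<in> supp_ops A"
proof -
  have "diffop \<iota> (\<lambda>_. 0) \<in> supp_ops A"
    by (rule supp_opsI) (auto simp: zero_in_H)
  moreover have "diffop \<iota> (\<lambda>_. 0) = 0"
    by (simp add: diffop_def fun_eq_iff)
  ultimately show ?thesis by metis
qed

lemma monop_in_supp_ops:
  assumes "c \<in> H" "\<alpha> \<in> A"
  shows "monop \<iota> c \<alpha> \<in> supp_ops A"
proof -
  let ?p = "\<lambda>\<beta>. if \<beta> = \<alpha> then c else 0"
  have sub: "{\<beta>. ?p \<beta> \<noteq> 0} \<subseteq> {\<alpha>}" by auto
  hence "diffop \<iota> ?p \<in> supp_ops A"
    using assms zero_in_H finite_subset[OF sub] by (intro supp_opsI) auto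
  moreover have "diffop \<iota> ?p = monop \<iota> c \<alpha>"
    by (subst diffop_eq_sum_monop[of "{\<alpha>}"]) auto
  ultimately show ?thesis by simp
qed

lemma add_in_supp_ops:
  assumes "U \<in> supp_ops A" "Y \<in> supp_ops A"
  shows "U + Y \<in> supp_ops A"
proof -
  obtain p where p: "U = diffop \<iota> p" "finite {\<alpha>. p \<alpha> \<noteq> 0}" "range p \<subseteq> H" "{\<alpha>. p \<alpha> \<noteq> 0} \<subseteq> A"
    using assms(1) by (rule supp_opsE)
  obtain q where q: "Y = diffop \<iota> q" "finite {\<alpha>. q \<alpha> \<noteq> 0}" "range q \<subseteq> H" "{\<alpha>. q \<alpha> \<noteq> 0} \<subseteq> A"
    using assms(2) by (rule supp_opsE)
  let ?r = "\<lambda>\<alpha>. p \<alpha> + q \<alpha>" and ?S = "{\<alpha>. p \<alpha> \<noteq> 0} \<union> {\<alpha>. q \<alpha> \<noteq> 0}"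
  have fin: "finite ?S" and sub: "{\<alpha>. ?r \<alpha> \<noteq> 0} \<subseteq> ?S" using p q by auto
  have "U + Y = diffop \<iota> ?r"
    unfolding p(1) q(1) using fin sub
    by (subst (1 2 3) diffop_eq_sum_monop[of ?S]) (auto simp: monop_add sum.distrib)
  moreover have "diffop \<iota> ?r \<in> supp_ops A"
  proof (rule supp_opsI)
    show "finite {\<alpha>. ?r \<alpha> \<noteq> 0}" using fin sub by (rule finite_subset[rotated])
    show "range ?r \<subseteq> H" using p(3) q(3) by (auto intro!: add_in_H)
    show "{\<alpha>. ?r \<alpha> \<noteq> 0} \<subseteq> A" using p q sub by blast
  qed
  ultimately show ?thesis by simp
qed

lemma sum_in_supp_ops:
  assumes "\<And>i. i \<in> I \<Longrightarrow> U i \<in> supp_ops A"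
  shows "(\<Sum>i\<in>I. U i) \<in> supp_ops A"
  using assms
proof (induction I rule: infinite_finite_induct)
  case (infinite I)
  thus "(\<Sum>i\<in>I. U i) \<in> supp_ops A" 
    by (metis sum.infinite zero_in_supp_ops)
next
  case empty
  show "(\<Sum>i\<in>{}. U i) \<in> supp_ops A" 
    by (metis sum.empty zero_in_supp_ops)
next
  case (insert i I)
  hence "U i + (\<Sum>i\<in>I. U i) \<in> supp_ops A" by (intro add_in_supp_ops) auto
  thus "(\<Sum>i\<in>insert i I. U i) \<in> supp_ops A" by (simp only: sum.insert[OF insert.hyps])
qed

lemma supp_ops_induct [consumes 1, case_names zero monop add]:
  assumes "U \<in> supp_ops A"
    and zero: "Q 0"
    and monop: "\<And>c \<alpha>. c \<in> H \<Longrightarrow> \<alpha> \<in> A \<Longrightarrow> Q (monop \<iota> c \<alpha>)"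
    and add: "\<And>Y Z. Q Y \<Longrightarrow> Q Z \<Longrightarrow> Q (Y + Z)"
  shows "Q U"
proof -
  obtain p where p: "U = diffop \<iota> p" "finite {\<alpha>. p \<alpha> \<noteq> 0}" "range p \<subseteq> H" "{\<alpha>. p \<alpha> \<noteq> 0} \<subseteq> A"
    using assms(1) by (rule supp_opsE)
  have "Q (\<Sum>\<alpha>\<in>S. monop \<iota> (p \<alpha>) \<alpha>)" if "finite S" "S \<subseteq> A" for S
    using that
  proof (induction S rule: finite_induct)
    case empty
    show "Q (\<Sum>\<alpha>\<in>{}. monop \<iota> (p \<alpha>) \<alpha>)" using zero by simp
  next
    case (insert \<alpha> S)
    hence "Q (monop \<iota> (p \<alpha>) \<alpha> + (\<Sum>\<alpha>\<in>S. monop \<iota> (p \<alpha>) \<alpha>))"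
      using p(3) by (intro add monop) auto
    thus "Q (\<Sum>\<alpha>\<in>insert \<alpha> S. monop \<iota> (p \<alpha>) \<alpha>)"
      using insert.hyps by simp
  qed
  from this[OF p(2,4)] show ?thesis
    unfolding p(1) using p(2) by (subst diffop_eq_sum_monop) auto
qed

lemma lmult_in_supp_ops:
  assumes "U \<in> supp_ops A" "q \<in> H"
  shows "(\<lambda>f. q * U f) \<in> supp_ops A"
  using assms(1)
proof (induction U rule: supp_ops_induct)
  case zero
  show ?case using zero_in_supp_ops by (simp add: zero_fun_def)
next
  case (monop c \<alpha>)
  have "(\<lambda>f. q * monop \<iota> c \<alpha> f) = monop \<iota> (q * c) \<alpha>"
    by (simp add: monop_def fun_eq_iff mult.assoc)
  thus ?case using monop assms(2) by (simp add: monop_in_supp_ops mult_in_H)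
next
  case (add Y Z)
  have "(\<lambda>f. q * (Y + Z) f) = (\<lambda>f. q * Y f) + (\<lambda>f. q * Z f)"
    by (simp add: fun_eq_iff distrib_left)
  thus ?case using add by (simp add: add_in_supp_ops)
qed

lemma uminus_in_supp_ops:
  assumes "U \<in> supp_ops A"
  shows "- U \<in> supp_ops A"
  using assms
proof (induction U rule: supp_ops_induct)
  case zero
  show "- 0 \<in> supp_ops A" using zero_in_supp_ops by simp
next
  case (monop c \<alpha>)
  have "- monop \<iota> c \<alpha> = monop \<iota> (- c) \<alpha>"
    by (simp add: monop_def fun_eq_iff)
  thus "- monop \<iota> c \<alpha> \<in> supp_ops A" using monop by (simp add: monop_in_supp_ops uminus_in_H)
next
  case (add Y Z)
  have "- (Y + Z) = - Y + - Z" by simp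
  thus "- (Y + Z) \<in> supp_ops A" using add by (simp only: add_in_supp_ops)
qed

lemma diff_in_supp_ops:
  assumes "U \<in> supp_ops A" "Y \<in> supp_ops A"
  shows "U - Y \<in> supp_ops A"
  using add_in_supp_ops[OF assms(1) uminus_in_supp_ops[OF assms(2)]] by simp

end


section \<open>Ideals of coefficients\<close>

context diff_coefficients
begin

text \<open>The combinations of finitely many generators already form an ideal, so the least ideal
  containing the generators consists of combinations.\<close>

lemma genideal_combination:
  assumes "ring (ring_on H)" "1 \<in> H" "finite I" "\<And>i. i \<in> I \<Longrightarrow> g i \<in> H"
    and "c \<in> genideal (ring_on H) (g ` I)"
  obtains q where "\<And>i. q i \<in> H" "c = (\<Sum>i\<in>I. q i * g i)"
proof -
  interpret R: ring "ring_on H" by (rule assms)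
  let ?K = "{\<Sum>i\<in>I. q i * g i | q. range q \<subseteq> H}"
  have sum_in: "(\<Sum>i\<in>J. x i) \<in> H" if "\<And>i. i \<in> J \<Longrightarrow> x i \<in> H" for J :: "'a set" and x
    using that by (induction J rule: infinite_finite_induct) (auto simp: zero_in_H add_in_H)
  have KI: "x \<in> ?K" if "range q \<subseteq> H" "x = (\<Sum>i\<in>I. q i * g i)" for x q
    using that by blast
  have inv: "inv\<^bsub>add_monoid (ring_on H)\<^esub> a = - a" if "a \<in> H" for a
    using R.add.inv_equality[of "- a" a] that uminus_in_H
    by (simp add: ring_of_type_algebra_def a_inv_def)
  have "ideal ?K (ring_on H)"
  proof (rule idealI)
    show "ring (ring_on H)" by (rule assms)
    show "subgroup ?K (add_monoid (ring_on H))"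
    proof (rule group.subgroupI[OF R.add.is_group])
      show "?K \<subseteq> carrier (add_monoid (ring_on H))"
        using assms(4) by (auto intro!: sum_in mult_in_H)
      show "?K \<noteq> {}"
        using KI[of "\<lambda>_. 0"] zero_in_H by auto
    next
      fix x assume "x \<in> ?K"
      then obtain q where q: "range q \<subseteq> H" "x = (\<Sum>i\<in>I. q i * g i)" by blast
      have x: "x \<in> H" unfolding q(2) using q(1) assms(4) by (auto intro!: sum_in mult_in_H)
      have "- x \<in> ?K"
        using q uminus_in_H by (intro KI[of "\<lambda>i. - q i"]) (auto simp: sum_negf)
      thus "inv\<^bsub>add_monoid (ring_on H)\<^esub> x \<in> ?K" using inv[OF x] by simp
    next
      fix x y assume "x \<in> ?K" "y \<in> ?K"
      then obtain q r where q: "range q \<subseteq> H" "x = (\<Sum>i\<in>I. q i * g i)"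
        and r: "range r \<subseteq> H" "y = (\<Sum>i\<in>I. r i * g i)" by blast
      have "x + y \<in> ?K"
        using q r add_in_H
        by (intro KI[of "\<lambda>i. q i + r i"]) (auto simp: distrib_right sum.distrib)
      thus "x \<otimes>\<^bsub>add_monoid (ring_on H)\<^esub> y \<in> ?K"
        by (simp add: ring_of_type_algebra_def)
    qed
  next
    fix x a assume "x \<in> ?K" and "a \<in> carrier (ring_on H)"
    then obtain q where q: "range q \<subseteq> H" "x = (\<Sum>i\<in>I. q i * g i)" and a: "a \<in> H" by auto
    have "a * x \<in> ?K"
      using q a mult_in_H
      by (intro KI[of "\<lambda>i. a * q i"]) (auto simp: sum_distrib_left mult.assoc)
    thus "a \<otimes>\<^bsub>ring_on H\<^esub> x \<in> ?K" "x \<otimes>\<^bsub>ring_on H\<^esub> a \<in> ?K"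
      by (simp_all add: ring_of_type_algebra_def mult.commute)
  qed
  moreover have "g ` I \<subseteq> ?K"
  proof
    fix x assume "x \<in> g ` I"
    then obtain i where i: "i \<in> I" "x = g i" by blast
    have "(\<Sum>j\<in>I. (if j = i then 1 else 0) * g j) = (\<Sum>j\<in>I. if j = i then g j else 0)"
      by (rule sum.cong) auto
    thus "x \<in> ?K"
      using i assms(2,3) zero_in_H by (intro KI[of "\<lambda>j. if j = i then 1 else 0"]) auto
  qed
  ultimately have "c \<in> ?K"
    using R.genideal_minimal assms(5) by blast
  then obtain q where "range q \<subseteq> H" "c = (\<Sum>i\<in>I. q i * g i)"
    by (elim CollectE exE conjE)
  thus ?thesis by (intro that[of q]) auto
qed

end


section \<open>Leading terms\<close>

locale ordered_diffops = diff_coefficients \<iota> H + term_order leq lt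
  for \<iota> :: "'n::finite \<Rightarrow> 'v::finite"
    and H :: "('v, 'k::{idom, ring_char_0}) mfps fract set"
    and leq lt :: "('n \<Rightarrow> nat) \<Rightarrow> ('n \<Rightarrow> nat) \<Rightarrow> bool"
begin

abbreviation ops_lt where "ops_lt \<epsilon> \<equiv> supp_ops {\<alpha>. lt \<alpha> \<epsilon>}"
abbreviation ops_le where "ops_le \<epsilon> \<equiv> supp_ops {\<alpha>. leq \<alpha> \<epsilon>}"

lemma fderiv_comp_ops_lt:
  assumes "U \<in> ops_lt \<epsilon>"
  shows "fderiv (\<iota> i) \<circ> U \<in> ops_lt (\<epsilon> + unit_exponent i)"
  using assms
proof (induction U rule: supp_ops_induct)
  case zero
  have "fderiv (\<iota> i) \<circ> 0 = (0 :: ('v, 'k) mfps fract \<Rightarrow> _)" by (simp add: fun_eq_iff)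
  thus "fderiv (\<iota> i) \<circ> 0 \<in> ops_lt (\<epsilon> + unit_exponent i)"
    by (metis zero_in_supp_ops)
next
  case (monop c \<alpha>)
  hence "lt (\<alpha> + unit_exponent i) (\<epsilon> + unit_exponent i)" "lt \<alpha> (\<epsilon> + unit_exponent i)"
    using add_right_less_iff less_add_unit ord.less_trans by blast+
  thus "fderiv (\<iota> i) \<circ> monop \<iota> c \<alpha> \<in> ops_lt (\<epsilon> + unit_exponent i)"
    unfolding fderiv_comp_monop using monop
    by (intro add_in_supp_ops monop_in_supp_ops fderiv_in_H) auto
next
  case (add Y Z)
  thus "fderiv (\<iota> i) \<circ> (Y + Z) \<in> ops_lt (\<epsilon> + unit_exponent i)"
    by (simp only: fderiv_comp_add add_in_supp_ops)
qed

lemma dpow_comp_leading_term: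
  assumes "U - monop \<iota> c \<epsilon> \<in> ops_lt \<epsilon>" "c \<in> H"
  shows "(dpow \<iota> \<gamma> \<circ> U) - monop \<iota> c (\<epsilon> + \<gamma>) \<in> ops_lt (\<epsilon> + \<gamma>)"
proof (induction \<gamma> rule: exponent_induct)
  case zero
  show "(dpow \<iota> 0 \<circ> U) - monop \<iota> c (\<epsilon> + 0) \<in> ops_lt (\<epsilon> + 0)"
    using assms(1) by (simp only: dpow_0 id_comp add_0_right)
next
  case (step \<gamma> i)
  let ?D = "fderiv (\<iota> i)" and ?Y = "dpow \<iota> \<gamma> \<circ> U" and ?M = "monop \<iota> c (\<epsilon> + \<gamma>)"
  have lower: "?Y - ?M \<in> ops_lt (\<epsilon> + \<gamma>)" by (rule step)
  have "dpow \<iota> (\<gamma> + unit_exponent i) \<circ> U = ?D \<circ> ((?Y - ?M) + ?M)"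
    by (simp add: dpow_add_unit comp_assoc)
  also have "\<dots> = (?D \<circ> (?Y - ?M)) + (monop \<iota> (?D c) (\<epsilon> + \<gamma>) +
      monop \<iota> c (\<epsilon> + \<gamma> + unit_exponent i))"
    by (simp only: fderiv_comp_add fderiv_comp_monop)
  finally have "(dpow \<iota> (\<gamma> + unit_exponent i) \<circ> U) - monop \<iota> c (\<epsilon> + (\<gamma> + unit_exponent i)) =
      (?D \<circ> (?Y - ?M)) + monop \<iota> (?D c) (\<epsilon> + \<gamma>)"
    by (simp add: add.assoc)
  also have "\<dots> \<in> ops_lt (\<epsilon> + \<gamma> + unit_exponent i)"
    using assms(2) less_add_unit
    by (intro add_in_supp_ops fderiv_comp_ops_lt[OF lower] monop_in_supp_ops fderiv_in_H) auto
  finally show ?case by (simp only: add.assoc)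
qed

text \<open>Left multiplication by \<open>q \<partial>\<^sup>\<gamma>\<close> multiplies the leading term as if the coefficients were
  constants, since all derivatives of coefficients land in lower exponents.\<close>

lemma monop_comp_leading_term:
  assumes "U - monop \<iota> c \<epsilon> \<in> ops_lt \<epsilon>" "c \<in> H" "q \<in> H"
  shows "(monop \<iota> q \<gamma> \<circ> U) - monop \<iota> (q * c) (\<epsilon> + \<gamma>) \<in> ops_lt (\<epsilon> + \<gamma>)"
proof -
  have "(monop \<iota> q \<gamma> \<circ> U) - monop \<iota> (q * c) (\<epsilon> + \<gamma>) =
      (\<lambda>f. q * ((dpow \<iota> \<gamma> \<circ> U) - monop \<iota> c (\<epsilon> + \<gamma>)) f)"
    by (simp add: monop_def fun_eq_iff right_diff_distrib mult.assoc)
  thus ?thesis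
    using lmult_in_supp_ops[OF dpow_comp_leading_term[OF assms(1,2)] assms(3)] by simp
qed

text \<open>This characterises \<^const>\<open>dexp\<close> and \<^const>\<open>dlcoeff\<close> through the filtration. It rests on the
  uniqueness of coefficients, hence on the injectivity of \<open>\<iota>\<close> and on characteristic zero.\<close>

lemma leading_term:
  assumes "U \<in> supp_ops A" "U \<noteq> 0"
  obtains \<epsilon> where "dexp \<iota> leq U = Some \<epsilon>" "\<epsilon> \<in> A" "dlcoeff \<iota> leq U \<in> H"
    "U - monop \<iota> (dlcoeff \<iota> leq U) \<epsilon> \<in> ops_lt \<epsilon>"
proof -
  obtain p where p: "U = diffop \<iota> p" "finite {\<alpha>. p \<alpha> \<noteq> 0}" "range p \<subseteq> H" "{\<alpha>. p \<alpha> \<noteq> 0} \<subseteq> A"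
    using assms(1) by (rule supp_opsE)
  let ?S = "{\<alpha>. p \<alpha> \<noteq> 0}"
  have dcoeff: "dcoeff \<iota> U = p"
    unfolding p(1) using inj p(2) by (rule dcoeff_diffop)
  have "?S \<noteq> {}"
  proof
    assume "?S = {}"
    hence "U = 0" by (simp add: p(1) diffop_def fun_eq_iff)
    thus False using assms(2) by simp
  qed
  define \<epsilon> where "\<epsilon> = ord.Max ?S"
  have \<epsilon>_in: "\<epsilon> \<in> ?S"
    unfolding \<epsilon>_def using p(2) \<open>?S \<noteq> {}\<close> by (rule ord.Max_in)
  have max: "leq \<alpha> \<epsilon>" if "\<alpha> \<in> ?S" for \<alpha>
    unfolding \<epsilon>_def using p(2) that by (rule ord.Max_ge)
  have dexp: "dexp \<iota> leq U = Some \<epsilon>"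
    using assms(2) by (simp add: dexp_def dcoeff \<epsilon>_def)
  have lc: "dlcoeff \<iota> leq U = p \<epsilon>"
    by (simp add: dlcoeff_def dexp dcoeff)
  have "U = monop \<iota> (p \<epsilon>) \<epsilon> + (\<Sum>\<alpha>\<in>?S - {\<epsilon>}. monop \<iota> (p \<alpha>) \<alpha>)"
    unfolding p(1) using p(2) \<epsilon>_in
    by (subst diffop_eq_sum_monop[of ?S]) (simp_all add: sum.remove)
  hence "U - monop \<iota> (p \<epsilon>) \<epsilon> = (\<Sum>\<alpha>\<in>?S - {\<epsilon>}. monop \<iota> (p \<alpha>) \<alpha>)"
    by simp
  also have "\<dots> \<in> ops_lt \<epsilon>"
    using p(3) max by (intro sum_in_supp_ops monop_in_supp_ops) (auto simp: ord.less_le)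
  finally show ?thesis
    using that[OF dexp] \<epsilon>_in p(3,4) lc by auto
qed

lemma dexp_le:
  assumes "U \<in> ops_le \<epsilon>"
  shows "le_bot leq (dexp \<iota> leq U) (Some \<epsilon>)"
proof (cases "U = 0")
  case True
  thus ?thesis by (simp add: dexp_def)
next
  case False
  with assms show ?thesis by (rule leading_term) simp
qed

lemma dexp_less:
  assumes "U \<in> ops_lt \<epsilon>"
  shows "dexp \<iota> leq U \<noteq> Some \<epsilon>"
proof (cases "U = 0")
  case True
  thus ?thesis by (simp add: dexp_def)
next
  case False
  with assms show ?thesis by (rule leading_term) auto
qed

lemma ops_leI:
  assumes "U \<in> diffops \<iota> H" "dexp \<iota> leq U = Some \<epsilon>"
  shows "U \<in> ops_le \<epsilon>"
proof -
  have "U \<noteq> 0" using assms(2) by (auto simp: dexp_def)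
  obtain c where c: "c \<in> H" "U - monop \<iota> c \<epsilon> \<in> ops_lt \<epsilon>"
    using assms(1) \<open>U \<noteq> 0\<close> unfolding diffops_eq_supp_ops
    by (rule leading_term) (use assms(2) in auto)
  have "U - monop \<iota> c \<epsilon> \<in> ops_le \<epsilon>"
    using c(2) by (rule supp_ops_mono[rotated]) (auto intro: ord.less_imp_le)
  moreover have "monop \<iota> c \<epsilon> \<in> ops_le \<epsilon>"
    using c(1) by (intro monop_in_supp_ops) auto
  ultimately have "(U - monop \<iota> c \<epsilon>) + monop \<iota> c \<epsilon> \<in> ops_le \<epsilon>"
    by (rule add_in_supp_ops)
  thus ?thesis by simp
qed

lemma ops_le_trans: "U \<in> ops_le \<delta> \<Longrightarrow> leq \<delta> \<epsilon> \<Longrightarrow> U \<in> ops_le \<epsilon>"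
  by (erule supp_ops_mono[rotated]) (auto intro: ord.order_trans)

lemma ops_le_diffops: "U \<in> ops_le \<epsilon> \<Longrightarrow> U \<in> diffops \<iota> H"
  unfolding diffops_eq_supp_ops by (erule supp_ops_mono[rotated]) simp

lemma ops_lt_cases:
  assumes "U \<in> ops_lt \<epsilon>" "U \<noteq> 0"
  obtains \<delta> where "lt \<delta> \<epsilon>" "U \<in> ops_le \<delta>"
proof -
  obtain \<delta> where \<delta>: "dexp \<iota> leq U = Some \<delta>" "lt \<delta> \<epsilon>"
    using assms by (rule leading_term) auto
  have "U \<in> diffops \<iota> H"
    unfolding diffops_eq_supp_ops using assms(1) by (rule supp_ops_mono[rotated]) simp
  thus ?thesis using that \<delta> ops_leI by blast
qed

lemma ops_ltI:
  assumes "U \<in> ops_le \<epsilon>" "dexp \<iota> leq U \<noteq> Some \<epsilon>"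
  shows "U \<in> ops_lt \<epsilon>"
proof (cases "U = 0")
  case True
  thus ?thesis by (simp add: zero_in_supp_ops)
next
  case False
  obtain \<delta> where \<delta>: "dexp \<iota> leq U = Some \<delta>" "leq \<delta> \<epsilon>"
    using assms(1) False by (rule leading_term) auto
  hence "lt \<delta> \<epsilon>" using assms(2) by (auto simp: ord.less_le)
  have "U \<in> ops_le \<delta>" using ops_leI[OF ops_le_diffops[OF assms(1)] \<delta>(1)] .
  thus ?thesis
    by (rule supp_ops_mono[rotated]) (use \<open>lt \<delta> \<epsilon>\<close> ord.le_less_trans in blast)
qed


section \<open>Division\<close>

text \<open>Non-reducedness writes the leading coefficient of \<open>P\<close> as \<open>\<Sum> q\<^sub>i c\<^sup>\<delta>(P\<^sub>i)\<close> over those \<open>i\<close> with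
  \<open>\<epsilon> = \<epsilon>\<^sub>i + \<gamma>\<^sub>i\<close>, where \<open>\<epsilon>\<^sub>i\<close> is the exponent of \<open>P\<^sub>i\<close>. The operators \<open>q\<^sub>i \<partial>\<^sup>\<gamma>\<^sub>i P\<^sub>i\<close> have the
  leading terms \<open>q\<^sub>i c\<^sup>\<delta>(P\<^sub>i) \<partial>\<^sup>\<epsilon>\<close>, which add up to that of \<open>P\<close>. A single such term may vanish
  (if \<open>q\<^sub>i = 0\<close>), so only the bound \<open>ops_le \<epsilon>\<close> is available for each summand.\<close>

lemma cancel_leading_term:
  fixes Ps :: "nat \<Rightarrow> ('v, 'k) mfps fract \<Rightarrow> ('v, 'k) mfps fract"
  assumes ring: "ring (ring_on H)" and one: "1 \<in> H" and I: "finite I"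
    and Ps: "\<And>i. i \<in> I \<Longrightarrow> Ps i \<in> diffops \<iota> H"
    and P: "P \<in> diffops \<iota> H" and not_reduced: "\<not> reduced \<iota> leq H (Ps ` I) P"
  obtains \<epsilon> T where "dexp \<iota> leq P = Some \<epsilon>"
    "\<And>i. T i \<in> diffops \<iota> H" "\<And>i. i \<in> I \<Longrightarrow> T i \<circ> Ps i \<in> ops_le \<epsilon>"
    "P - (\<Sum>i\<in>I. T i \<circ> Ps i) \<in> ops_lt \<epsilon>"
proof -
  let ?lc = "dlcoeff \<iota> leq"
  have "P \<noteq> 0" using not_reduced by (auto simp: reduced_def)
  with P obtain \<epsilon> where \<epsilon>: "dexp \<iota> leq P = Some \<epsilon>" and
    P_lt: "P - monop \<iota> (?lc P) \<epsilon> \<in> ops_lt \<epsilon>"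
    unfolding diffops_eq_supp_ops by (rule leading_term)
  define J where "J = {i \<in> I. \<epsilon> \<in> exp_cone \<iota> leq (Ps i)}"
  have J: "finite J" "J \<subseteq> I" using I by (auto simp: J_def)
  have "?lc P \<in> lc_ideal \<iota> leq H \<epsilon> (Ps ` I)"
    using not_reduced \<epsilon> by (auto simp: reduced_def)
  also have "lc_ideal \<iota> leq H \<epsilon> (Ps ` I) = genideal (ring_on H) ((\<lambda>i. ?lc (Ps i)) ` J)"
    unfolding lc_ideal_def J_def by (rule arg_cong[where f = "genideal _"]) auto
  finally have in_ideal: "?lc P \<in> genideal (ring_on H) ((\<lambda>i. ?lc (Ps i)) ` J)" .
  have "\<exists>\<gamma> \<epsilon>'. \<epsilon> = \<epsilon>' + \<gamma> \<and> ?lc (Ps i) \<in> H \<and> Ps i - monop \<iota> (?lc (Ps i)) \<epsilon>' \<in> ops_lt \<epsilon>'"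
    if i: "i \<in> J" for i
  proof -
    obtain \<epsilon>' \<gamma> where \<epsilon>': "\<epsilon> = \<epsilon>' + \<gamma>" "dexp \<iota> leq (Ps i) = Some \<epsilon>'"
      using i by (auto simp: J_def exp_cone_def)
    have "Ps i \<in> supp_ops UNIV"
      using Ps[of i] i J(2) by (auto simp: diffops_eq_supp_ops)
    moreover have "Ps i \<noteq> 0" using \<epsilon>'(2) by (auto simp: dexp_def)
    ultimately show ?thesis by (rule leading_term) (use \<epsilon>' in auto)
  qed
  then obtain \<gamma> \<epsilon>' where lead: "\<And>i. i \<in> J \<Longrightarrow> \<epsilon> = \<epsilon>' i + \<gamma> i \<and> ?lc (Ps i) \<in> H \<and>
      Ps i - monop \<iota> (?lc (Ps i)) (\<epsilon>' i) \<in> ops_lt (\<epsilon>' i)"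
    by metis
  obtain q where q: "\<And>i. q i \<in> H" "?lc P = (\<Sum>i\<in>J. q i * ?lc (Ps i))"
    using genideal_combination[OF ring one J(1) _ in_ideal] lead by blast
  define T where "T i = (if i \<in> J then monop \<iota> (q i) (\<gamma> i) else 0)" for i
  let ?M = "\<lambda>i. monop \<iota> (q i * ?lc (Ps i)) \<epsilon>"
  have T_lt: "(T i \<circ> Ps i) - ?M i \<in> ops_lt \<epsilon>" if "i \<in> J" for i
    using monop_comp_leading_term[of "Ps i" "?lc (Ps i)" "\<epsilon>' i" "q i" "\<gamma> i"] lead[OF that] q(1)
    by (simp add: T_def that)
  show ?thesis
  proof (rule that[OF \<epsilon>])
    show "T i \<in> diffops \<iota> H" for i
      by (auto simp: T_def diffops_eq_supp_ops intro!: monop_in_supp_ops zero_in_supp_ops q)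
    show "T i \<circ> Ps i \<in> ops_le \<epsilon>" for i
    proof (cases "i \<in> J")
      case True
      have "(T i \<circ> Ps i) - ?M i \<in> ops_le \<epsilon>"
        using T_lt[OF True] by (rule supp_ops_mono[rotated]) (auto intro: ord.less_imp_le)
      moreover have "?M i \<in> ops_le \<epsilon>"
        using lead[OF True] q(1) by (intro monop_in_supp_ops mult_in_H) auto
      ultimately have "((T i \<circ> Ps i) - ?M i) + ?M i \<in> ops_le \<epsilon>" by (rule add_in_supp_ops)
      thus ?thesis by simp
    next
      case False
      hence "T i \<circ> Ps i = 0" by (simp add: T_def fun_eq_iff)
      thus ?thesis by (simp add: zero_in_supp_ops)
    qed
    have "(\<Sum>i\<in>I. T i \<circ> Ps i) = (\<Sum>i\<in>J. T i \<circ> Ps i)"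
      using I J(2) by (intro sum.mono_neutral_right) (auto simp: T_def fun_eq_iff)
    moreover have "monop \<iota> (?lc P) \<epsilon> = (\<Sum>i\<in>J. ?M i)"
      unfolding q(2) by (rule monop_sum)
    ultimately have "P - (\<Sum>i\<in>I. T i \<circ> Ps i) =
        (P - monop \<iota> (?lc P) \<epsilon>) - (\<Sum>i\<in>J. (T i \<circ> Ps i) - ?M i)"
      by (simp add: sum_subtractf)
    also have "\<dots> \<in> ops_lt \<epsilon>"
      by (intro diff_in_supp_ops[OF P_lt] sum_in_supp_ops T_lt)
    finally show "P - (\<Sum>i\<in>I. T i \<circ> Ps i) \<in> ops_lt \<epsilon>" .
  qed
qed

text \<open>Being reduced concerns the leading term alone, so the process stops at the first remainder that
  is reduced and never examines its lower terms. The bound on the \<open>Q\<^sub>i P\<^sub>i\<close> is part of the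
  statement: it survives the induction because every later contribution has a smaller exponent,
  and it could not be recovered from the sum, in which leading terms may cancel.\<close>

lemma division:
  fixes Ps :: "nat \<Rightarrow> ('v, 'k) mfps fract \<Rightarrow> ('v, 'k) mfps fract"
  assumes ring: "ring (ring_on H)" and one: "1 \<in> H" and I: "finite I"
    and Ps: "\<And>i. i \<in> I \<Longrightarrow> Ps i \<in> diffops \<iota> H"
    and "P \<in> ops_le \<epsilon>"
  shows "\<exists>Q R. (\<forall>i\<in>I. Q i \<in> diffops \<iota> H) \<and> P = (\<Sum>i\<in>I. Q i \<circ> Ps i) + R \<and>
    reduced \<iota> leq H (Ps ` I) R \<and> R \<in> ops_le \<epsilon> \<and> (\<forall>i\<in>I. Q i \<circ> Ps i \<in> ops_le \<epsilon>)"
  using assms(5)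
proof (induction \<epsilon> arbitrary: P rule: ord.less_induct)
  case (less \<epsilon>)
  have stop: ?case if "reduced \<iota> leq H (Ps ` I) P"
  proof (intro exI conjI ballI)
    have zero: "(0 :: ('v, 'k) mfps fract \<Rightarrow> ('v, 'k) mfps fract) \<circ> Ps i = 0" for i
      by (simp add: fun_eq_iff)
    show "P = (\<Sum>i\<in>I. 0 \<circ> Ps i) + P" "0 \<circ> Ps i \<in> ops_le \<epsilon>" for i
      by (simp_all add: zero zero_in_supp_ops)
    show "0 \<in> diffops \<iota> H" by (simp add: diffops_eq_supp_ops zero_in_supp_ops)
  qed (use that less.prems in auto)
  show ?case
  proof (cases "reduced \<iota> leq H (Ps ` I) P")
    case True
    thus ?thesis by (rule stop)
  next
    case False
    obtain \<delta> T where \<delta>: "dexp \<iota> leq P = Some \<delta>"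
      and T: "\<And>i. T i \<in> diffops \<iota> H" "\<And>i. i \<in> I \<Longrightarrow> T i \<circ> Ps i \<in> ops_le \<delta>"
      and lt: "P - (\<Sum>i\<in>I. T i \<circ> Ps i) \<in> ops_lt \<delta>" (is "?P' \<in> _")
      using cancel_leading_term[OF ring one I Ps ops_le_diffops[OF less.prems] False] by blast
    have \<delta>_le: "leq \<delta> \<epsilon>" using dexp_le[OF less.prems] \<delta> by simp
    have T_le: "T i \<circ> Ps i \<in> ops_le \<epsilon>" if "i \<in> I" for i
      using T(2)[OF that] \<delta>_le by (rule ops_le_trans)
    show ?thesis
    proof (cases "?P' = 0")
      case True
      hence "P = (\<Sum>i\<in>I. T i \<circ> Ps i) + 0" by simp
      moreover have "reduced \<iota> leq H (Ps ` I) 0" by (simp only: reduced_def simp_thms)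
      ultimately show ?thesis
        using T(1) T_le zero_in_supp_ops by blast
    next
      case False
      with lt obtain \<delta>' where \<delta>': "lt \<delta>' \<delta>" "?P' \<in> ops_le \<delta>'" by (rule ops_lt_cases)
      have less': "lt \<delta>' \<epsilon>" using \<delta>'(1) \<delta>_le by (rule ord.less_le_trans)
      obtain Q R where Q: "\<forall>i\<in>I. Q i \<in> diffops \<iota> H" "?P' = (\<Sum>i\<in>I. Q i \<circ> Ps i) + R"
        "reduced \<iota> leq H (Ps ` I) R" "R \<in> ops_le \<delta>'" "\<forall>i\<in>I. Q i \<circ> Ps i \<in> ops_le \<delta>'"
        using less.IH[OF less' \<delta>'(2)] by blast
      have comp_add: "(Q i + T i) \<circ> Ps i = (Q i \<circ> Ps i) + (T i \<circ> Ps i)" for i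
        by (simp add: fun_eq_iff)
      have "P = ?P' + (\<Sum>i\<in>I. T i \<circ> Ps i)" by simp
      also have "\<dots> = (\<Sum>i\<in>I. (Q i + T i) \<circ> Ps i) + R"
        unfolding Q(2) comp_add sum.distrib by (simp add: algebra_simps)
      finally have "P = (\<Sum>i\<in>I. (Q i + T i) \<circ> Ps i) + R" .
      moreover have "Q i + T i \<in> diffops \<iota> H" if "i \<in> I" for i
        using Q(1) T(1) that unfolding diffops_eq_supp_ops by (auto intro: add_in_supp_ops)
      moreover have "(Q i + T i) \<circ> Ps i \<in> ops_le \<epsilon>" if "i \<in> I" for i
        unfolding comp_add using Q(5) T_le that ops_le_trans ord.less_imp_le[OF less']
        by (intro add_in_supp_ops) auto
      moreover have "R \<in> ops_le \<epsilon>"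
        using Q(4) ord.less_imp_le[OF less'] by (rule ops_le_trans)
      ultimately show ?thesis
        using Q(3) by (intro exI[of _ "\<lambda>i. Q i + T i"] exI[of _ R]) blast
    qed
  qed
qed

text \<open>The bound on the summands becomes an equality because the exponent of a sum cannot exceed all
  the exponents of its summands.\<close>

lemma Max_dexp_summands:
  assumes I: "finite I" and P: "P = (\<Sum>i\<in>I. U i) + R" "dexp \<iota> leq P = Some \<epsilon>"
    and le: "\<And>i. i \<in> I \<Longrightarrow> U i \<in> ops_le \<epsilon>" "R \<in> ops_le \<epsilon>"
  shows "linorder.Max (le_bot leq) (insert (dexp \<iota> leq R) {dexp \<iota> leq (U i) | i. i \<in> I}) =
    Some \<epsilon>"
proof -
  let ?S = "insert (dexp \<iota> leq R) {dexp \<iota> leq (U i) | i. i \<in> I}"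
  interpret bot: linorder "le_bot leq" "\<lambda>x y. le_bot leq x y \<and> \<not> le_bot leq y x"
    by (rule linorder_le_bot)
  have S: "?S = insert (dexp \<iota> leq R) ((\<lambda>i. dexp \<iota> leq (U i)) ` I)" by blast
  have "Some \<epsilon> \<in> ?S"
  proof (rule ccontr)
    assume "Some \<epsilon> \<notin> ?S"
    hence "dexp \<iota> leq R \<noteq> Some \<epsilon>" "\<And>i. i \<in> I \<Longrightarrow> dexp \<iota> leq (U i) \<noteq> Some \<epsilon>"
      unfolding S by (metis insertI1, metis insertI2 imageI)
    hence "R \<in> ops_lt \<epsilon>" "\<And>i. i \<in> I \<Longrightarrow> U i \<in> ops_lt \<epsilon>"
      using le by (auto intro!: ops_ltI)
    hence "P \<in> ops_lt \<epsilon>"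
      unfolding P(1) by (intro add_in_supp_ops sum_in_supp_ops)
    thus False using P(2) dexp_less by blast
  qed
  moreover have "finite ?S" using I by (simp add: S)
  moreover have "le_bot leq y (Some \<epsilon>)" if "y \<in> ?S" for y
    using that le by (auto simp: S intro: dexp_le)
  ultimately show ?thesis by (intro bot.Max_eqI)
qed

end


section \<open>The division theorem\<close>

theorem theorem15:
  fixes \<iota> :: "'n::finite \<Rightarrow> 'v::finite"
    and H :: "('v, 'k::field_char_0) mfps fract set"
    and leq lt :: "('n \<Rightarrow> nat) \<Rightarrow> ('n \<Rightarrow> nat) \<Rightarrow> bool"
    and m :: nat
    and Ps :: "nat \<Rightarrow> ('v, 'k) mfps fract \<Rightarrow> ('v, 'k) mfps fract"
    and P :: "('v, 'k) mfps fract \<Rightarrow> ('v, 'k) mfps fract"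
  assumes "inj \<iota>"
    and "subring H ring_of_type_algebra"
    and "range fconst \<subseteq> H"
    and "noetherian_ring (ring_on H)"
    and "\<And>i h. h \<in> H \<Longrightarrow> fderiv (\<iota> i) h \<in> H"
    and "class.wellorder leq lt"
    and "\<And>\<alpha> \<beta> \<gamma>. lt (\<alpha> + \<gamma>) (\<beta> + \<gamma>) \<longleftrightarrow> lt \<alpha> \<beta>"
    and "\<And>i. i \<in> {1..m} \<Longrightarrow> Ps i \<in> diffops \<iota> H"
    and "\<And>i. i \<in> {1..m} \<Longrightarrow> Ps i \<noteq> 0"
    and "P \<in> diffops \<iota> H"
  shows "\<exists>Q R. (\<forall>i\<in>{1..m}. Q i \<in> diffops \<iota> H) \<and> R \<in> diffops \<iota> H \<and>
    P = (\<Sum>i = 1..m. Q i \<circ> Ps i) + R \<and>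
    reduced \<iota> leq H (Ps ` {1..m}) R \<and>
    linorder.Max (le_bot leq)
      (insert (dexp \<iota> leq R) {dexp \<iota> leq (Q i \<circ> Ps i) | i. i \<in> {1..m}}) = dexp \<iota> leq P"
proof -
  note H_sub = subringE[OF assms(2)]
  have H: "0 \<in> H" "1 \<in> H" "\<And>a b. a \<in> H \<Longrightarrow> b \<in> H \<Longrightarrow> a + b \<in> H"
    "\<And>a b. a \<in> H \<Longrightarrow> b \<in> H \<Longrightarrow> a * b \<in> H"
    using H_sub by (simp_all add: ring_of_type_algebra_def)
  have ring: "ring (ring_on H)"
    using assms(4) by (simp add: noetherian_ring_def)
  have uminus: "- a \<in> H" if "a \<in> H" for a
  proof -
    interpret R: ring "ring_on H" by (rule ring)
    have "\<exists>b\<in>H. b + a = 0"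
      using R.add.l_inv_ex[of a] that by (simp add: ring_of_type_algebra_def)
    thus ?thesis by (metis eq_neg_iff_add_eq_0)
  qed
  interpret ordered_diffops \<iota> H leq lt
    using assms(1,5-7) H uminus
    by (intro ordered_diffops.intro diff_coefficients.intro term_order.intro) auto
  show ?thesis
  proof (cases "P = 0")
    case True
    \<comment> \<open>Here all exponents are \<open>-\<infinity>\<close>, which is not the bound of a level of the filtration.\<close>
    let ?O = "0 :: ('v, 'k) mfps fract \<Rightarrow> ('v, 'k) mfps fract"
    have zero: "?O \<circ> Ps i = 0" for i
      by (simp add: fun_eq_iff)
    interpret bot: linorder "le_bot leq" "\<lambda>x y. le_bot leq x y \<and> \<not> le_bot leq y x"
      by (rule linorder_le_bot)
    have "insert (dexp \<iota> leq ?O) {dexp \<iota> leq (?O \<circ> Ps i) | i. i \<in> {1..m}} = {dexp \<iota> leq P}"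
      unfolding zero True by blast
    hence "bot.Max (insert (dexp \<iota> leq ?O) {dexp \<iota> leq (?O \<circ> Ps i) | i. i \<in> {1..m}}) =
        dexp \<iota> leq P"
      by (simp only: bot.Max_singleton)
    moreover have "P = (\<Sum>i = 1..m. ?O \<circ> Ps i) + 0"
      unfolding zero True by simp
    moreover have "?O \<in> diffops \<iota> H"
      unfolding diffops_eq_supp_ops by (rule zero_in_supp_ops)
    moreover have "reduced \<iota> leq H (Ps ` {1..m}) ?O"
      by (simp only: reduced_def simp_thms)
    ultimately show ?thesis
      by (intro exI[of _ "\<lambda>_. ?O"] exI[of _ ?O] conjI ballI)
  next
    case False
    obtain \<epsilon> where \<epsilon>: "dexp \<iota> leq P = Some \<epsilon>" using False by (simp add: dexp_def)
    have "P \<in> ops_le \<epsilon>" using assms(10) \<epsilon> by (rule ops_leI)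
    from division[where I = "{1..m}" and Ps = Ps,
        OF ring H(2) finite_atLeastAtMost assms(8) this] obtain Q R where
      Q: "\<forall>i\<in>{1..m}. Q i \<in> diffops \<iota> H" "P = (\<Sum>i = 1..m. Q i \<circ> Ps i) + R"
        "reduced \<iota> leq H (Ps ` {1..m}) R" "R \<in> ops_le \<epsilon>"
        "\<forall>i\<in>{1..m}. Q i \<circ> Ps i \<in> ops_le \<epsilon>"
      by blast
    have "linorder.Max (le_bot leq)
        (insert (dexp \<iota> leq R) {dexp \<iota> leq (Q i \<circ> Ps i) | i. i \<in> {1..m}}) = dexp \<iota> leq P"
      unfolding \<epsilon> by (rule Max_dexp_summands[OF _ Q(2) \<epsilon>]) (use Q(4,5) in auto)
    thus ?thesis using Q ops_le_diffops[OF Q(4)] by (intro exI[of _ Q] exI[of _ R]) blast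
  qed
qed

end
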